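(* Let $\hat g_i(c)$ and $(X_i^c,P_i^c)$, for $i\in\{1,\dots,k\}$ and $c\in\mathbb R$, be the cumulative tradeoff functions and corresponding optimal single-period mechanisms defined in the context, and let $c_0$ be a maximizer of $c\mapsto \hat g_1(c)$. Consider the mechanism that on each day $i=1,\dots,k$, when the buyer reports $v_i$, allocates item $i$ with probability $X_i^{c_{i-1}}(v_i)$, charges $v_iX_i^{c_{i-1}}(v_i)$ if $i<k$ and $P_i^{c_{i-1}}(v_i)$ if $i=k$, and sets $c_i=v_iX_i^{c_{i-1}}(v_i)-P_i^{c_{i-1}}(v_i)$. Then this mechanism is an optimal solution to the original problem (revenue maximization subject to periodic incentive compatibility and ex-post individual rationality).
   Context: Setting. Fix $k\ge 1$. A seller sells items $1,\dots,k$ to a single buyer over $k$ days. The buyer's value for item $i$ is $v_i\in[\underline v_i,\bar v_i]$ with $0\le \underline v_i<\bar v_i<\infty$, drawn independently of the other values from a distribution with density $f_i$ with support $[\underline v_i,\bar v_i]$, and $v_i$ is learned by the buyer at the beginning of day $i$. Write $v_{\le i}=(v_1,\dots,v_i)$, $v_{<i}=(v_1,\dots,v_{i-1})$; $(v_{\le j},v_i')$ is $v_{\le j}$ with its $i$-th entry replaced by $v_i'$. A mechanism is a sequence of (measurable) functions $x_i(v_{\le i})\in[0,1]$ (allocation probability) and $p_i(v_{\le i})\in\mathbb R$ (payment), $i=1,\dots,k$. Original problem: maximize $\mathbf E[\sum_{i=1}^k p_i(v_{\le i})]$ subject to (periodic incentive compatibility) for all $i$, $v_{\le i}$, $v_i'$: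 $v_ix_i(v_{\le i})-p_i(v_{\le i})+\mathbf E_{v_{i+1},\dots,v_k}[\sum_{j>i}(v_jx_j(v_{\le j})-p_j(v_{\le j}))]\ \ge\ v_ix_i(v_{<i},v_i')-p_i(v_{<i},v_i')+\mathbf E_{v_{i+1},\dots,v_k}[\sum_{j>i}(v_jx_j(v_{\le j},v_i')-p_j(v_{\le j},v_i'))]$; (ex-post individual rationality) $v_ix_i(v_{\le i})-p_i(v_{\le i})\ge 0$ for all $i$, $v_{\le i}$. Tight surplus-utility-tradeoff problem with density $f$, utility level $c\in\mathbb R$ and tradeoff function $g:\mathbb R\to\mathbb R\cup\{-\infty\}$: over functions $x(v)\in[0,1]$, $p(v)\in\mathbb R$ of a single value $v$, maximize $\mathbf E_{v\sim f}[vx(v)+g(vx(v)-p(v))]$ subject to incentive compatibility $vx(v)-p(v)\ge vx(v')-p(v')$ for all $v,v'$, and $\mathbf E_{v\sim f}[vx(v)-p(v)]=c$. Cumulative tradeoff functions: set $\hat g_{k+1}(u)=0$ if $u\ge 0$ and $\hat g_{k+1}(u)=-\infty$ if $u<0$. Recursively for $i=k,k-1,\dots,1$, $\hat g_i(c)$ is the optimal value of the tight surplus-utility-tradeoff problem with density $f_i$, utility level $c$, and tradeoff function $g(u)=\hat g_{i+1}(u)$ if $i\ge 2$, $g(u)=\hat g_2(u)-u$ if $i=1$; $(X_i^c,P_i^c)$ denotes an optimal mechanism for that problem (chosen measurably in $c$). *)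

theory Defs
  imports "HOL-Probability.Probability"
begin

section \<open>Expectations with values in the extended reals\<close>

text \<open>
  Tradeoff functions take the value \<open>-\<infinity>\<close>, and the utilities of a mechanism need not be
  integrable, so expectations are formed in \<^typ>\<open>ereal\<close>. Since \<^const>\<open>e2ennreal\<close> sends
  negative numbers to 0, the two integrals below are those of the positive and negative part.
  They are never both infinite where this is used: the objective functions and the revenue of a
  feasible mechanism are bounded above, the continuation utility of an individually rational
  mechanism is nonnegative.
\<close>

definition ereal_expectation :: "'a measure \<Rightarrow> ('a \<Rightarrow> ereal) \<Rightarrow> ereal" where
  "ereal_expectation M h =
     enn2ereal (\<integral>\<^sup>+ x. e2ennreal (h x) \<partial>M) - enn2ereal (\<integral>\<^sup>+ x. e2ennreal (- h x) \<partial>M)"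


section \<open>Value distributions\<close>

definition measure_support :: "'a::topological_space measure \<Rightarrow> 'a set" where
  "measure_support M = {x. \<forall>U. open U \<and> x \<in> U \<longrightarrow> emeasure M U > 0}"

definition density_with_support :: "(real \<Rightarrow> real) \<Rightarrow> real \<Rightarrow> real \<Rightarrow> bool" where
  "density_with_support f a b \<longleftrightarrow>
     f \<in> borel_measurable borel \<and> (\<forall>v. 0 \<le> f v) \<and> (\<integral>\<^sup>+ v. ennreal (f v) \<partial>lborel) = 1 \<and>
     measure_support (density lborel (\<lambda>v. ennreal (f v))) = {a..b}"

text \<open>The distribution of the value of item \<open>i\<close>, as a measure on the interval \<open>{lo i..hi i}\<close>;
  the space of this measure is the set of possible values and reports.\<close>

definition value_dist ::
  "(nat \<Rightarrow> real \<Rightarrow> real) \<Rightarrow> (nat \<Rightarrow> real) \<Rightarrow> (nat \<Rightarrow> real) \<Rightarrow> nat \<Rightarrow> real measure" where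
  "value_dist f lo hi i = restrict_space (density lborel (\<lambda>v. ennreal (f i v))) {lo i..hi i}"


section \<open>The original problem\<close>

text \<open>
  \<open>D i\<close> is the distribution of \<open>v\<^sub>i\<close>. The history \<open>v\<^bsub>\<le>i\<^esub>\<close> is an element of the space of
  \<open>PiM {1..i} D\<close>, that is, a function on \<open>{1..i}\<close> that is \<open>undefined\<close> elsewhere; independence of
  the values is expressed by the product measures.
\<close>

type_synonym rule = "nat \<Rightarrow> (nat \<Rightarrow> real) \<Rightarrow> real"

text \<open>Sum of the utilities on days \<open>j > i\<close>, in expectation over truthfully reported later values,
  when \<open>h\<close> is the sequence of reports on days \<open>1, \<dots>, i\<close>.\<close>

definition continuation_utility ::
  "nat \<Rightarrow> (nat \<Rightarrow> real measure) \<Rightarrow> rule \<Rightarrow> rule \<Rightarrow> nat \<Rightarrow> (nat \<Rightarrow> real) \<Rightarrow> ereal" where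
  "continuation_utility k D x p i h =
     ereal_expectation (PiM {i<..k} D) (\<lambda>w. ereal (\<Sum>j\<in>{i<..k}.
       w j * x j (restrict (merge {1..i} {i<..k} (h, w)) {1..j})
         - p j (restrict (merge {1..i} {i<..k} (h, w)) {1..j})))"

definition is_mechanism :: "nat \<Rightarrow> (nat \<Rightarrow> real measure) \<Rightarrow> rule \<Rightarrow> rule \<Rightarrow> bool" where
  "is_mechanism k D x p \<longleftrightarrow>
     (\<forall>i\<in>{1..k}. x i \<in> borel_measurable (PiM {1..i} D) \<and> p i \<in> borel_measurable (PiM {1..i} D) \<and>
        (\<forall>v\<in>space (PiM {1..i} D). x i v \<in> {0..1}))"

definition periodic_IC :: "nat \<Rightarrow> (nat \<Rightarrow> real measure) \<Rightarrow> rule \<Rightarrow> rule \<Rightarrow> bool" where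
  "periodic_IC k D x p \<longleftrightarrow>
     (\<forall>i\<in>{1..k}. \<forall>v\<in>space (PiM {1..i} D). \<forall>v'\<in>space (D i).
        ereal (v i * x i v - p i v) + continuation_utility k D x p i v \<ge>
        ereal (v i * x i (v(i := v')) - p i (v(i := v')))
          + continuation_utility k D x p i (v(i := v')))"

definition ex_post_IR :: "nat \<Rightarrow> (nat \<Rightarrow> real measure) \<Rightarrow> rule \<Rightarrow> rule \<Rightarrow> bool" where
  "ex_post_IR k D x p \<longleftrightarrow>
     (\<forall>i\<in>{1..k}. \<forall>v\<in>space (PiM {1..i} D). v i * x i v - p i v \<ge> 0)"

definition feasible_mechanism :: "nat \<Rightarrow> (nat \<Rightarrow> real measure) \<Rightarrow> rule \<Rightarrow> rule \<Rightarrow> bool" where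
  "feasible_mechanism k D x p \<longleftrightarrow>
     is_mechanism k D x p \<and> periodic_IC k D x p \<and> ex_post_IR k D x p"

definition revenue :: "nat \<Rightarrow> (nat \<Rightarrow> real measure) \<Rightarrow> rule \<Rightarrow> ereal" where
  "revenue k D p =
     ereal_expectation (PiM {1..k} D) (\<lambda>v. ereal (\<Sum>i=1..k. p i (restrict v {1..i})))"

definition optimal_mechanism :: "nat \<Rightarrow> (nat \<Rightarrow> real measure) \<Rightarrow> rule \<Rightarrow> rule \<Rightarrow> bool" where
  "optimal_mechanism k D x p \<longleftrightarrow>
     feasible_mechanism k D x p \<and>
     (\<forall>x' p'. feasible_mechanism k D x' p' \<longrightarrow> revenue k D p' \<le> revenue k D p)"


section \<open>The tight surplus-utility-tradeoff problem\<close>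

definition tight_feasible ::
  "real measure \<Rightarrow> real \<Rightarrow> (real \<Rightarrow> real) \<Rightarrow> (real \<Rightarrow> real) \<Rightarrow> bool" where
  "tight_feasible M c x p \<longleftrightarrow>
     x \<in> borel_measurable M \<and> p \<in> borel_measurable M \<and>
     (\<forall>v\<in>space M. x v \<in> {0..1}) \<and>
     (\<forall>v\<in>space M. \<forall>v'\<in>space M. v * x v - p v \<ge> v * x v' - p v') \<and>
     has_bochner_integral M (\<lambda>v. v * x v - p v) c"

definition tight_objective ::
  "real measure \<Rightarrow> (real \<Rightarrow> ereal) \<Rightarrow> (real \<Rightarrow> real) \<Rightarrow> (real \<Rightarrow> real) \<Rightarrow> ereal" where
  "tight_objective M g x p = ereal_expectation M (\<lambda>v. ereal (v * x v) + g (v * x v - p v))"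

definition tight_value :: "real measure \<Rightarrow> real \<Rightarrow> (real \<Rightarrow> ereal) \<Rightarrow> ereal" where
  "tight_value M c g = (SUP (x, p)\<in>{(x, p). tight_feasible M c x p}. tight_objective M g x p)"

definition tight_optimal ::
  "real measure \<Rightarrow> real \<Rightarrow> (real \<Rightarrow> ereal) \<Rightarrow> (real \<Rightarrow> real) \<Rightarrow> (real \<Rightarrow> real) \<Rightarrow> bool" where
  "tight_optimal M c g x p \<longleftrightarrow>
     tight_feasible M c x p \<and>
     (\<forall>x' p'. tight_feasible M c x' p' \<longrightarrow> tight_objective M g x' p' \<le> tight_objective M g x p)"


section \<open>Cumulative tradeoff functions\<close>

function ghat :: "nat \<Rightarrow> (nat \<Rightarrow> real measure) \<Rightarrow> nat \<Rightarrow> real \<Rightarrow> ereal" where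
  "ghat k D i c =
     (if i > k then (if c \<ge> 0 then 0 else - \<infinity>)
      else tight_value (D i) c
        (\<lambda>u. if i = 1 then ghat k D (Suc i) u - ereal u else ghat k D (Suc i) u))"
  by pat_completeness auto
termination
  by (relation "Wellfounded.measure (\<lambda>(k, D, i, c). Suc k - i)") auto

declare ghat.simps [simp del]

definition day_tradeoff :: "nat \<Rightarrow> (nat \<Rightarrow> real measure) \<Rightarrow> nat \<Rightarrow> real \<Rightarrow> ereal" where
  "day_tradeoff k D i u = (if i = 1 then ghat k D 2 u - ereal u else ghat k D (Suc i) u)"

lemma ghat_eq_tight_value:
  "i \<le> k \<Longrightarrow> ghat k D i c = tight_value (D i) c (day_tradeoff k D i)"
  by (subst ghat.simps) (auto simp: day_tradeoff_def numeral_2_eq_2 intro!: arg_cong[where f = "tight_value (D i) c"])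


section \<open>The mechanism built from single-period mechanisms\<close>

text \<open>\<open>utility_level X P c0 i v\<close> is \<open>c\<^sub>i\<close> after reports \<open>v 1, \<dots>, v i\<close>;
  \<open>X i c\<close> and \<open>P i c\<close> are the single-period mechanism for day \<open>i\<close> and utility level \<open>c\<close>.\<close>

primrec utility_level ::
  "(nat \<Rightarrow> real \<Rightarrow> real \<Rightarrow> real) \<Rightarrow> (nat \<Rightarrow> real \<Rightarrow> real \<Rightarrow> real) \<Rightarrow> real \<Rightarrow> nat \<Rightarrow> (nat \<Rightarrow> real) \<Rightarrow> real" where
  "utility_level X P c0 0 v = c0"
| "utility_level X P c0 (Suc i) v =
     v (Suc i) * X (Suc i) (utility_level X P c0 i v) (v (Suc i))
       - P (Suc i) (utility_level X P c0 i v) (v (Suc i))"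

definition composed_allocation ::
  "(nat \<Rightarrow> real \<Rightarrow> real \<Rightarrow> real) \<Rightarrow> (nat \<Rightarrow> real \<Rightarrow> real \<Rightarrow> real) \<Rightarrow> real \<Rightarrow> rule" where
  "composed_allocation X P c0 i v = X i (utility_level X P c0 (i - 1) v) (v i)"

definition composed_payment ::
  "nat \<Rightarrow> (nat \<Rightarrow> real \<Rightarrow> real \<Rightarrow> real) \<Rightarrow> (nat \<Rightarrow> real \<Rightarrow> real \<Rightarrow> real) \<Rightarrow> real \<Rightarrow> rule" where
  "composed_payment k X P c0 i v =
     (if i < k then v i * X i (utility_level X P c0 (i - 1) v) (v i)
      else P i (utility_level X P c0 (i - 1) v) (v i))"

end

theory Submission
  imports Defs
begin

text \<open>
  Write \<open>U\<^sub>i(h)\<close> and \<open>S\<^sub>i(h)\<close> for the expected utility and the expected surplus of the days after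
  \<open>i\<close>, given the reports \<open>h\<close> of the first \<open>i\<close> days, so that the revenue is \<open>S\<^sub>0 - U\<^sub>0\<close>. Along any
  feasible mechanism, adding \<open>U\<^sub>i\<close> to the utility of day \<open>i\<close> gives an incentive compatible
  single-period mechanism with expected utility \<open>U\<^bsub>i-1\<^esub>\<close>. By individual rationality its utility is at
  least \<open>U\<^sub>i\<close>, and the tradeoff functions are nondecreasing, so backward induction yields
  \<open>S\<^sub>i(h) \<le> ghat\<^bsub>i+1\<^esub>(U\<^sub>i(h))\<close> for \<open>i \<ge> 1\<close>, hence a revenue of at most \<open>ghat\<^sub>1(U\<^sub>0) \<le> ghat\<^sub>1(c\<^sub>0)\<close>. For the composed
  mechanism \<open>U\<^sub>i = c\<^sub>i\<close> for \<open>i < k\<close> and all these inequalities are equalities. The levels \<open>c\<^sub>i\<close> stay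
  nonnegative for every report, not only almost surely: an incentive compatible utility is nondecreasing
  and continuous, so if it is negative somewhere then it is negative with positive probability, where the
  tradeoff function is \<open>-\<infinity>\<close>.
\<close>

section \<open>Expectations in the extended reals\<close>

lemma ereal_expectation_cong:
  assumes "\<And>x. x \<in> space M \<Longrightarrow> h x = h' x"
  shows "ereal_expectation M h = ereal_expectation M h'"
  unfolding ereal_expectation_def
  using assms by (intro arg_cong2[where f = "(-)"] arg_cong[where f = enn2ereal] nn_integral_cong) auto

lemma ereal_expectation_mono:
  assumes "\<And>x. x \<in> space M \<Longrightarrow> h x \<le> h' x"
  shows "ereal_expectation M h \<le> ereal_expectation M h'"
  unfolding ereal_expectation_def
  using assms by (intro ereal_minus_mono)
    (auto simp: less_eq_ennreal.rep_eq[symmetric] intro!: nn_integral_mono e2ennreal_mono)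

text \<open>Lets an expectation be split into a minuend with finite integral and a subtrahend that
  may be infinite. The truncated differences satisfy pos + E[B] = E[A] + neg, and pos is at most
  E[A], hence finite, so the terms can be moved across.\<close>

lemma ereal_expectation_diff:
  assumes [measurable]: "A \<in> borel_measurable M" "B \<in> borel_measurable M"
    and A_finite: "\<And>x. x \<in> space M \<Longrightarrow> A x \<noteq> \<top>" "(\<integral>\<^sup>+ x. A x \<partial>M) \<noteq> \<top>"
  shows "ereal_expectation M (\<lambda>x. enn2ereal (A x) - enn2ereal (B x)) =
    enn2ereal (\<integral>\<^sup>+ x. A x \<partial>M) - enn2ereal (\<integral>\<^sup>+ x. B x \<partial>M)"
proof -
  define pos where "pos = (\<integral>\<^sup>+ x. A x - B x \<partial>M)"
  define neg where "neg = (\<integral>\<^sup>+ x. B x - A x \<partial>M)"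
  have e: "ereal_expectation M (\<lambda>x. enn2ereal (A x) - enn2ereal (B x)) = enn2ereal pos - enn2ereal neg"
    unfolding ereal_expectation_def pos_def neg_def
    by (simp add: ereal_minus_diff_eq A_finite e2eenreal_enn2ereal_diff
        cong: nn_integral_cong)
  have "pos + (\<integral>\<^sup>+ x. B x \<partial>M) = (\<integral>\<^sup>+ x. (A x - B x) + B x \<partial>M)"
    unfolding pos_def by (simp add: nn_integral_add)
  \<comment> \<open>With truncated subtraction both integrands are the pointwise maximum of
    \<open>A\<close> and \<open>B\<close>.\<close>
  also have "\<dots> = (\<integral>\<^sup>+ x. A x + (B x - A x) \<partial>M)"
  proof (intro nn_integral_cong)
    fix x assume "x \<in> space M"
    then have "A x \<noteq> \<top>" using A_finite by auto
    then show "A x - B x + B x = A x + (B x - A x)"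
      by (cases "A x"; cases "B x"; cases "enn2real (A x) \<le> enn2real (B x)")
        (auto simp: ennreal_minus ennreal_neg simp flip: ennreal_plus)
  qed
  also have "\<dots> = (\<integral>\<^sup>+ x. A x \<partial>M) + neg"
    unfolding neg_def by (simp add: nn_integral_add)
  finally have sum: "pos + (\<integral>\<^sup>+ x. B x \<partial>M) = (\<integral>\<^sup>+ x. A x \<partial>M) + neg" .
  have "pos \<le> (\<integral>\<^sup>+ x. A x \<partial>M)"
    unfolding pos_def by (intro nn_integral_mono diff_le_self_ennreal)
  with A_finite(2) sum e show ?thesis
    by (cases pos; cases neg; cases "\<integral>\<^sup>+ x. A x \<partial>M"; cases "\<integral>\<^sup>+ x. B x \<partial>M")
      (auto simp: top_unique simp flip: ennreal_plus)
qed

lemma ereal_expectation_nonneg_eq: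
  assumes "\<And>x. x \<in> space M \<Longrightarrow> 0 \<le> h x"
  shows "ereal_expectation M h = enn2ereal (\<integral>\<^sup>+ x. e2ennreal (h x) \<partial>M)"
proof -
  have "(\<integral>\<^sup>+ x. e2ennreal (- h x) \<partial>M) = 0"
    using assms by (intro nn_integral_zero' AE_I2) (auto simp: e2ennreal_neg)
  then show ?thesis
    unfolding ereal_expectation_def by (simp add: zero_ennreal.rep_eq)
qed

section \<open>A single day\<close>

lemma tight_feasibleD:
  assumes "tight_feasible M c x p"
  shows "x \<in> borel_measurable M" "p \<in> borel_measurable M"
    "\<And>v. v \<in> space M \<Longrightarrow> 0 \<le> x v" "\<And>v. v \<in> space M \<Longrightarrow> x v \<le> 1"
    "\<And>v v'. v \<in> space M \<Longrightarrow> v' \<in> space M \<Longrightarrow> v * x v' - p v' \<le> v * x v - p v"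
    "has_bochner_integral M (\<lambda>v. v * x v - p v) c"
  using assms unfolding tight_feasible_def by auto

text \<open>The invariant of the backward recursion. The value minus infinity encodes individual
  rationality, monotonicity lets utility be added, and the bounds keep the objective well
  defined.\<close>

definition tradeoff_function :: "(real \<Rightarrow> ereal) \<Rightarrow> bool" where
  "tradeoff_function g \<longleftrightarrow> mono g \<and> (\<forall>u<0. g u = - \<infinity>) \<and> (\<exists>B. \<forall>u\<ge>0. 0 \<le> g u \<and> g u \<le> ereal B)"

lemma tradeoff_functionE:
  assumes "tradeoff_function g"
  obtains B where "mono g" "\<And>u. u < 0 \<Longrightarrow> g u = - \<infinity>" "\<And>u. 0 \<le> u \<Longrightarrow> 0 \<le> g u"
    "\<And>u. g u \<le> ereal B" "0 \<le> B"
proof -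
  from assms obtain B where B: "mono g" "\<forall>u<0. g u = - \<infinity>" "\<forall>u\<ge>0. 0 \<le> g u \<and> g u \<le> ereal B"
    by (auto simp: tradeoff_function_def)
  moreover have "g u \<le> ereal B" for u
    using B by (cases "u < 0") auto
  moreover have "ereal 0 \<le> ereal B"
    using B(3)[rule_format, of 0] by (metis order_trans order_refl zero_ereal_def)
  ultimately show thesis by (intro that) auto
qed

text \<open>The function \<open>g\<close> composed with \<open>max 0\<close> is real valued and
  monotone, hence Borel; on negative arguments \<open>e2ennreal\<close> turns minus infinity into
  0.\<close>

lemma borel_measurable_tradeoff:
  assumes "tradeoff_function g"
  shows "(\<lambda>u. e2ennreal (g u)) \<in> borel_measurable borel"
proof -
  obtain B where B: "mono g" "\<And>u. u < 0 \<Longrightarrow> g u = - \<infinity>" "\<And>u. 0 \<le> u \<Longrightarrow> 0 \<le> g u"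
    "\<And>u. g u \<le> ereal B" using tradeoff_functionE[OF assms] by metis
  define r where "r u = real_of_ereal (g (max 0 u))" for u
  have r: "ereal (r u) = g (max 0 u)" for u
    using B(3)[of "max 0 u"] B(4)[of "max 0 u"] unfolding r_def
    by (intro ereal_real') auto
  have "mono r"
    using B(1) by (auto simp: mono_def r[symmetric] simp flip: ereal_less_eq(3))
      (simp add: r)
  then have [measurable]: "r \<in> borel_measurable borel"
    by (rule borel_measurable_mono)
  have "e2ennreal (g u) = (if u < 0 then 0 else ennreal (r u))" for u
    using r[of u] B(2)[of u] by (auto simp: e2ennreal_neg max_def simp flip: e2ennreal_ereal)
  then show ?thesis by simp
qed

text \<open>Of the support condition only mass near the lower end is kept: an incentive compatible
  utility is smallest there, so that is where its sign is decided.\<close>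

locale value_space = prob_space M for M :: "real measure" +
  fixes a b :: real
  assumes space_eq: "space M = {a..b}"
    and sets_eq: "sets M = sets (restrict_space borel {a..b})"
    and nonneg: "0 \<le> a" and less: "a < b"
    and lower_end_pos: "\<And>c. a < c \<Longrightarrow> emeasure M {v\<in>space M. v < c} > 0"
begin

lemma id_measurable [measurable]: "(\<lambda>v. v) \<in> borel_measurable M"
  by (subst measurable_cong_sets[OF sets_eq refl]) (auto intro: measurable_restrict_space1)

lemma space_nonneg: "v \<in> space M \<Longrightarrow> 0 \<le> v"
  using space_eq nonneg by auto

lemma surplus_bounds:
  assumes "tight_feasible M c x p" "v \<in> space M"
  shows "0 \<le> v * x v" "v * x v \<le> b"
proof -
  have "0 \<le> x v" "x v \<le> 1" "0 \<le> v" "v \<le> b"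
    using tight_feasibleD[OF assms(1)] assms(2) space_nonneg space_eq by auto
  then show "0 \<le> v * x v" "v * x v \<le> b"
    using mult_mono[of v b "x v" 1] by auto
qed

text \<open>Incentive compatibility makes the utility nondecreasing and 1-Lipschitz. If it is
  negative at \<open>w\<close>, it is negative at \<open>a\<close>, and it stays negative on an
  interval to the right of \<open>a\<close>.\<close>

lemma negative_utility_pos_measure:
  assumes feas: "tight_feasible M c x p" and w: "w \<in> space M" "w * x w - p w < 0"
  shows "emeasure M {v\<in>space M. v * x v - p v < 0} > 0"
proof -
  note [measurable] = tight_feasibleD(1,2)[OF feas]
  note x01 = tight_feasibleD(3,4)[OF feas] and IC = tight_feasibleD(5)[OF feas]
  have aM: "a \<in> space M" using less by (simp add: space_eq)
  have "a * x a - p a + (w - a) * x a \<le> w * x w - p w"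
    using IC[OF w(1) aM] by (simp add: algebra_simps)
  moreover have "0 \<le> (w - a) * x a"
    using x01(1)[OF aM] w(1) by (simp add: space_eq)
  ultimately have neg: "a * x a - p a < 0" using w by linarith
  \<comment> \<open>The utility at \<open>a\<close> is \<open>a - c'\<close> and grows with slope at
    most 1, so it cannot reach 0 before \<open>c'\<close>.\<close>
  define c' where "c' = a - (a * x a - p a)"
  have "v * x v - p v < 0" if v: "v \<in> space M" "v < c'" for v
  proof -
    have "v * x v - p v - (v - a) * x v \<le> a * x a - p a"
      using IC[OF aM v(1)] by (simp add: algebra_simps)
    moreover have "(v - a) * x v \<le> v - a"
      using x01[OF v(1)] v(1) by (intro mult_left_le) (auto simp: space_eq)
    ultimately show ?thesis using v(2) by (simp add: c'_def)
  qed
  then have "emeasure M {v\<in>space M. v < c'} \<le> emeasure M {v\<in>space M. v * x v - p v < 0}"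
    by (intro emeasure_mono) auto
  moreover have "a < c'" using neg by (simp add: c'_def)
  ultimately show ?thesis using lower_end_pos[of c'] by (meson less_le_trans)
qed

lemma utility_level_nonneg:
  assumes "tight_feasible M c x p" "\<And>v. v \<in> space M \<Longrightarrow> 0 \<le> v * x v - p v"
  shows "0 \<le> c"
proof -
  have "c = (\<integral>v. v * x v - p v \<partial>M)"
    using has_bochner_integral_integral_eq[OF tight_feasibleD(6)[OF assms(1)]] by simp
  moreover have "0 \<le> (\<integral>v. v * x v - p v \<partial>M)"
    using assms(2) by (rule Bochner_Integration.integral_nonneg)
  ultimately show ?thesis by simp
qed

text \<open>The single-day objective as a nonnegative integral, without the linear term of the first
  day. It is faithful when the utilities are nonnegative, since \<open>e2ennreal\<close> would hide
  the value minus infinity.\<close>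

definition stage_value :: "(real \<Rightarrow> ereal) \<Rightarrow> (real \<Rightarrow> real) \<Rightarrow> (real \<Rightarrow> real) \<Rightarrow> ennreal" where
  "stage_value g x p = (\<integral>\<^sup>+ v. ennreal (v * x v) + e2ennreal (g (v * x v - p v)) \<partial>M)"

lemma stage_value_le:
  assumes "tight_feasible M c x p" "\<And>u. g u \<le> ereal B" "0 \<le> B"
  shows "stage_value g x p \<le> ennreal (b + B)"
proof -
  have "stage_value g x p \<le> (\<integral>\<^sup>+ v. ennreal (b + B) \<partial>M)"
    unfolding stage_value_def
  proof (intro nn_integral_mono)
    fix v assume "v \<in> space M"
    then have "ennreal (v * x v) + e2ennreal (g (v * x v - p v)) \<le> ennreal b + ennreal B"
      using surplus_bounds[OF assms(1)] e2ennreal_mono[OF assms(2)]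
      by (intro add_mono ennreal_leI) (auto simp del: e2ennreal_ereal simp flip: e2ennreal_ereal)
    then show "ennreal (v * x v) + e2ennreal (g (v * x v - p v)) \<le> ennreal (b + B)"
      using assms(3) nonneg less by (simp add: ennreal_plus)
  qed
  then show ?thesis by (simp add: emeasure_space_1)
qed

text \<open>The parameter \<open>d\<close> is 1 on the first day, whose utility is subtracted from
  revenue, and 0 later. Tightness fixes the mean utility at \<open>c\<close>, so the linear term
  contributes the constant \<open>d * c\<close>.\<close>

lemma tight_objective_nonneg_utility:
  assumes g: "tradeoff_function g" and feas: "tight_feasible M c x p" and "0 \<le> d"
    and u: "\<And>v. v \<in> space M \<Longrightarrow> 0 \<le> v * x v - p v"
  shows "tight_objective M (\<lambda>u. g u - ereal (d * u)) x p = enn2ereal (stage_value g x p) - ereal (d * c)"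
proof -
  obtain B where B: "\<And>u. 0 \<le> u \<Longrightarrow> 0 \<le> g u" "\<And>u. g u \<le> ereal B" "0 \<le> B"
    using tradeoff_functionE[OF g] by metis
  note [measurable] = tight_feasibleD(1,2)[OF feas] borel_measurable_tradeoff[OF g]
  have int: "(\<integral>\<^sup>+ v. ennreal (d * (v * x v - p v)) \<partial>M) = ennreal (d * c)"
  proof (rule nn_integral_eq_integral[THEN trans])
    show "integrable M (\<lambda>v. d * (v * x v - p v))"
      using tight_feasibleD(6)[OF feas] by (auto simp: has_bochner_integral_iff)
    show "AE v in M. 0 \<le> d * (v * x v - p v)"
      using u \<open>0 \<le> d\<close> by (intro AE_I2) auto
    show "ennreal (\<integral>v. d * (v * x v - p v) \<partial>M) = ennreal (d * c)"
      using tight_feasibleD(6)[OF feas] by (simp add: has_bochner_integral_iff)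
  qed
  have c: "0 \<le> c" using utility_level_nonneg[OF feas u] .
  have "tight_objective M (\<lambda>u. g u - ereal (d * u)) x p = ereal_expectation M (\<lambda>v.
      enn2ereal (ennreal (v * x v) + e2ennreal (g (v * x v - p v))) - enn2ereal (ennreal (d * (v * x v - p v))))"
    unfolding tight_objective_def
  proof (rule ereal_expectation_cong)
    fix v assume v: "v \<in> space M"
    then have "0 \<le> g (v * x v - p v)" "g (v * x v - p v) \<noteq> \<infinity>"
      using B(1)[OF u[OF v]] B(2)[of "v * x v - p v"] by auto
    then obtain r where r: "g (v * x v - p v) = ereal r" "0 \<le> r"
      by (cases "g (v * x v - p v)") auto
    show "ereal (v * x v) + (g (v * x v - p v) - ereal (d * (v * x v - p v))) =
      enn2ereal (ennreal (v * x v) + e2ennreal (g (v * x v - p v))) - enn2ereal (ennreal (d * (v * x v - p v)))"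
      using r surplus_bounds[OF feas v] u[OF v] \<open>0 \<le> d\<close>
      by (simp add: enn2ereal_ennreal flip: ennreal_plus)
  qed
  also have "\<dots> = enn2ereal (stage_value g x p) - enn2ereal (ennreal (d * c))"
    unfolding stage_value_def int[symmetric]
  proof (rule ereal_expectation_diff)
    show "(\<integral>\<^sup>+ v. ennreal (v * x v) + e2ennreal (g (v * x v - p v)) \<partial>M) \<noteq> \<top>"
      using stage_value_le[of c x p g B, OF feas B(2,3)] unfolding stage_value_def by (auto simp: top_unique)
    show "ennreal (v * x v) + e2ennreal (g (v * x v - p v)) \<noteq> \<top>" for v
      using e2ennreal_mono[OF B(2)[of "v * x v - p v"]] by (auto simp: top_unique)
  qed measurable
  finally show ?thesis
    using c \<open>0 \<le> d\<close> by (simp add: enn2ereal_ennreal)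
qed

text \<open>One negative type forces a set of negative types of positive measure, on which the
  integrand is minus infinity. The positive part is bounded by \<open>b + B\<close>, so nothing
  compensates.\<close>

lemma tight_objective_negative_utility:
  assumes g: "tradeoff_function g" and feas: "tight_feasible M c x p" and "0 \<le> d"
    and w: "w \<in> space M" "w * x w - p w < 0"
  shows "tight_objective M (\<lambda>u. g u - ereal (d * u)) x p = - \<infinity>"
proof -
  obtain B where B: "\<And>u. u < 0 \<Longrightarrow> g u = - \<infinity>" "\<And>u. g u \<le> ereal B" "0 \<le> B"
    using tradeoff_functionE[OF g] by metis
  note [measurable] = tight_feasibleD(1,2)[OF feas]
  define h where "h v = ereal (v * x v) + (g (v * x v - p v) - ereal (d * (v * x v - p v)))" for v
  have neg: "h v = - \<infinity>" if "v * x v - p v < 0" for v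
    using B(1)[OF that] by (simp add: h_def)
  have "(\<integral>\<^sup>+ v. e2ennreal (h v) \<partial>M) \<le> (\<integral>\<^sup>+ v. ennreal (b + B) \<partial>M)"
  proof (intro nn_integral_mono)
    fix v assume v: "v \<in> space M"
    have "h v \<le> ereal (b + B)"
    proof (cases "v * x v - p v < 0")
      case True
      then show ?thesis by (simp add: neg)
    next
      case False
      then have "0 \<le> d * (v * x v - p v)" using \<open>0 \<le> d\<close> by auto
      then show ?thesis
        using surplus_bounds[OF feas v] B(2)[of "v * x v - p v"]
        unfolding h_def by (cases "g (v * x v - p v)") auto
    qed
    then show "e2ennreal (h v) \<le> ennreal (b + B)"
      using e2ennreal_mono by fastforce
  qed
  then have pos: "(\<integral>\<^sup>+ v. e2ennreal (h v) \<partial>M) < \<top>"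
    by (simp add: emeasure_space_1 le_less_trans)
  have "\<top> = (\<integral>\<^sup>+ v. \<top> * indicator {v\<in>space M. v * x v - p v < 0} v \<partial>M)"
    using negative_utility_pos_measure[OF feas w]
    by (subst nn_integral_cmult_indicator) (auto simp: ennreal_top_mult)
  also have "\<dots> \<le> (\<integral>\<^sup>+ v. e2ennreal (- h v) \<partial>M)"
    by (intro nn_integral_mono) (auto simp: indicator_def neg)
  finally have "(\<integral>\<^sup>+ v. e2ennreal (- h v) \<partial>M) = \<top>"
    by (simp add: top_unique)
  with pos show ?thesis
    unfolding tight_objective_def ereal_expectation_def h_def[symmetric]
    by (cases "\<integral>\<^sup>+ v. e2ennreal (h v) \<partial>M") (auto simp: enn2ereal_ennreal)
qed

text \<open>The induction step for the cumulative tradeoff functions after the first day: one round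
  of optimization preserves the invariant.\<close>

lemma tradeoff_function_tight_value:
  assumes g: "tradeoff_function g"
  shows "tradeoff_function (\<lambda>c. tight_value M c g)"
proof -
  obtain B where B: "mono g" "\<And>u. 0 \<le> u \<Longrightarrow> 0 \<le> g u" "\<And>u. g u \<le> ereal B" "0 \<le> B"
    using tradeoff_functionE[OF g] by metis
  have g0: "(\<lambda>u. g u - ereal (0 * u)) = g" by (simp add: zero_ereal_def[symmetric])
  have "tight_value M c g \<le> tight_value M c' g" if "c \<le> c'" for c c'
    unfolding tight_value_def
  proof (rule SUP_mono)
    fix xp assume "xp \<in> {(x, p). tight_feasible M c x p}"
    then obtain x p where xp: "xp = (x, p)" and feas: "tight_feasible M c x p" by auto
    \<comment> \<open>A uniform rebate of \<open>c' - c\<close> raises the level while keeping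
      allocation and incentives.\<close>
    let ?p = "\<lambda>v. p v - (c' - c)"
    have u: "v * x v - ?p v = (v * x v - p v) + (c' - c)" for v by simp
    have "has_bochner_integral M (\<lambda>v. (v * x v - p v) + (c' - c)) (c + (c' - c))"
      using tight_feasibleD(6)[OF feas] prob_space
      by (intro has_bochner_integral_add) (auto simp: has_bochner_integral_iff)
    then have "tight_feasible M c' x ?p"
      using feas unfolding tight_feasible_def u by (auto simp: algebra_simps)
    moreover have "tight_objective M g x p \<le> tight_objective M g x ?p"
      unfolding tight_objective_def u using B(1) that
      by (intro ereal_expectation_mono add_mono) (auto simp: mono_def)
    ultimately show "\<exists>xp'\<in>{(x, p). tight_feasible M c' x p}.
        (case xp of (x, p) \<Rightarrow> tight_objective M g x p) \<le> (case xp' of (x, p) \<Rightarrow> tight_objective M g x p)"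
      by (intro bexI[of _ "(x, ?p)"]) (auto simp: xp)
  qed
  moreover have "tight_value M c g = - \<infinity>" if "c < 0" for c
  proof -
    have "tight_objective M g x p = - \<infinity>" if feas: "tight_feasible M c x p" for x p
    proof -
      obtain w where "w \<in> space M" "w * x w - p w < 0"
        using utility_level_nonneg[OF feas] \<open>c < 0\<close> by force
      from tight_objective_negative_utility[OF g feas order_refl this] show ?thesis
        unfolding g0 .
    qed
    then show ?thesis
      unfolding tight_value_def
      by (auto intro!: antisym SUP_least)
  qed
  moreover have "0 \<le> tight_value M c g" if "0 \<le> c" for c
  proof -
    \<comment> \<open>Selling nothing and paying \<open>c\<close> to the buyer gives every type
      utility exactly \<open>c\<close>.\<close>
    have "tight_feasible M c (\<lambda>_. 0) (\<lambda>_. - c)"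
      using prob_space by (auto simp: tight_feasible_def has_bochner_integral_iff)
    moreover have "0 \<le> tight_objective M g (\<lambda>_. 0) (\<lambda>_. - c)"
      using B(2)[OF that] unfolding tight_objective_def
      by (subst ereal_expectation_nonneg_eq) auto
    ultimately show ?thesis
      unfolding tight_value_def by (intro SUP_upper2[of "(\<lambda>_. 0, \<lambda>_. - c)"]) auto
  qed
  moreover have "tight_value M c g \<le> ereal (b + B)" for c
    unfolding tight_value_def
  proof (rule SUP_least, clarsimp)
    fix x p assume feas: "tight_feasible M c x p"
    show "tight_objective M g x p \<le> ereal (b + B)"
    proof (cases "\<forall>v\<in>space M. 0 \<le> v * x v - p v")
      case True
      then have "tight_objective M g x p = enn2ereal (stage_value g x p)"
        using tight_objective_nonneg_utility[OF g feas order_refl] unfolding g0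
        by (simp add: zero_ereal_def[symmetric])
      also have "\<dots> \<le> enn2ereal (ennreal (b + B))"
        using stage_value_le[OF feas B(3,4)] by (simp add: less_eq_ennreal.rep_eq)
      finally show ?thesis
        using nonneg less B(4) by (simp add: enn2ereal_ennreal del: ennreal_plus)
    next
      case False
      then obtain w where "w \<in> space M" "w * x w - p w < 0" by force
      from tight_objective_negative_utility[OF g feas order_refl this] show ?thesis
        unfolding g0 by simp
    qed
  qed
  ultimately show ?thesis
    unfolding tradeoff_function_def mono_def by (intro conjI allI impI exI[of _ "b + B"]) simp_all
qed

end

section \<open>Sums over later days\<close>

locale value_sequence =
  fixes k :: nat and D :: "nat \<Rightarrow> real measure" and lo hi :: "nat \<Rightarrow> real"
  assumes day: "\<And>i. i \<in> {1..k} \<Longrightarrow> value_space (D i) (lo i) (hi i)"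
begin

lemma prob_space_histories: "J \<subseteq> {1..k} \<Longrightarrow> prob_space (PiM J D)"
  by (intro prob_space_PiM value_space.axioms(1)[OF day]) auto

lemma nn_integral_PiM_insert:
  assumes J: "finite J" "i \<notin> J" "insert i J \<subseteq> {1..k}"
    and f: "f \<in> borel_measurable (PiM (insert i J) D)"
  shows "(\<integral>\<^sup>+ w. f w \<partial>PiM (insert i J) D) = (\<integral>\<^sup>+ v. (\<integral>\<^sup>+ w. f (w(i := v)) \<partial>PiM J D) \<partial>D i)"
proof -
  \<comment> \<open>\<^locale>\<open>product_sigma_finite\<close> asks for all factors, but nothing is known outside \<open>{1..k}\<close>.\<close>
  define D' where "D' j = (if j \<in> {1..k} then D j else count_space {undefined})" for j
  interpret D': product_sigma_finite D'
  proof (rule product_sigma_finite.intro)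
    fix j show "sigma_finite_measure (D' j)"
      using value_space.axioms(1)[OF day, of j]
      by (auto simp: D'_def prob_space_imp_sigma_finite intro!: sigma_finite_measure_count_space_finite)
  qed
  have eq: "PiM (insert i J) D = PiM (insert i J) D'" "PiM J D = PiM J D'" "D i = D' i"
    using J by (auto simp: D'_def subset_eq intro!: PiM_cong)
  show ?thesis
    using D'.product_nn_integral_insert_rev[OF J(1,2)] f unfolding eq by simp
qed

text \<open>Generic in the daily quantity \<open>t\<close>, so that surplus and utility share one
  recursion. Negative summands are cut to 0 by \<open>ennreal\<close>; it is used for rules that are
  nonnegative on histories.\<close>

definition expected_later :: "rule \<Rightarrow> nat \<Rightarrow> (nat \<Rightarrow> real) \<Rightarrow> ennreal" where
  "expected_later t i h = (\<integral>\<^sup>+ w. (\<Sum>j\<in>{i<..k}.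
     ennreal (t j (restrict (merge {1..i} {i<..k} (h, w)) {1..j}))) \<partial>PiM {i<..k} D)"

definition measurable_rule :: "rule \<Rightarrow> bool" where
  "measurable_rule t \<longleftrightarrow> (\<forall>j\<in>{1..k}. t j \<in> borel_measurable (PiM {1..j} D))"

section \<open>Splitting and extending histories, and the one-day recursion\<close>

lemma merge_history:
  assumes "h \<in> space (PiM {1..i} D)" "w \<in> space (PiM {i<..k} D)" "i \<le> k"
  shows "merge {1..i} {i<..k} (h, w) \<in> space (PiM {1..k} D)"
  using assms by (auto simp: space_PiM PiE_def Pi_def extensional_def merge_def)

lemma restrict_history:
  assumes "h \<in> space (PiM {1..n} D)" "i \<le> n"
  shows "restrict h {1..i} \<in> space (PiM {1..i} D)"
  using assms by (auto simp: space_PiM PiE_def Pi_def)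

lemma extend_history:
  assumes "h \<in> space (PiM {1..i} D)" "v \<in> space (D (Suc i))"
  shows "h(Suc i := v) \<in> space (PiM {1..Suc i} D)"
  using assms by (auto simp: space_PiM PiE_def Pi_def extensional_def)

lemma history_cases:
  assumes "h' \<in> space (PiM {1..Suc i} D)"
  obtains h v where "h \<in> space (PiM {1..i} D)" "v \<in> space (D (Suc i))" "h' = h(Suc i := v)"
proof (rule that)
  show "restrict h' {1..i} \<in> space (PiM {1..i} D)" using restrict_history[OF assms] by simp
  show "h' (Suc i) \<in> space (D (Suc i))" using assms by (auto simp: space_PiM)
  show "h' = (restrict h' {1..i})(Suc i := h' (Suc i))"
    using assms by (auto simp: space_PiM PiE_def extensional_def fun_eq_iff)
qed

lemma update_history:
  assumes "h \<in> space (PiM {1..i} D)" "v \<in> space (D i)" "i \<in> {1..k}"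
  shows "h(i := v) \<in> space (PiM {1..i} D)"
  using assms by (auto simp: space_PiM PiE_def Pi_def extensional_def)

lemma measurable_extend_history:
  assumes "h \<in> space (PiM {1..i} D)"
  shows "(\<lambda>v. h(Suc i := v)) \<in> measurable (D (Suc i)) (PiM {1..Suc i} D)"
  using measurable_component_update[OF assms, of "Suc i"]
  by (simp add: atLeastAtMostSuc_conv)

lemma measurable_sum_later:
  assumes t: "measurable_rule t" and "i \<le> k"
  shows "(\<lambda>(h, w). \<Sum>j\<in>{i<..k}. ennreal (t j (restrict (merge {1..i} {i<..k} (h, w)) {1..j})))
    \<in> borel_measurable (PiM {1..i} D \<Otimes>\<^sub>M PiM {i<..k} D)"
proof -
  have U: "{1..i} \<union> {i<..k} = {1..k}" using \<open>i \<le> k\<close> by auto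
  have "(\<lambda>hw. t j (restrict (merge {1..i} {i<..k} hw) {1..j}))
      \<in> borel_measurable (PiM {1..i} D \<Otimes>\<^sub>M PiM {i<..k} D)" if "j \<in> {i<..k}" for j
  proof -
    have "(\<lambda>v. restrict v {1..j}) \<in> measurable (PiM ({1..i} \<union> {i<..k}) D) (PiM {1..j} D)"
      unfolding U using that by (intro measurable_restrict_subset) auto
    moreover have "t j \<in> borel_measurable (PiM {1..j} D)"
      using t that by (auto simp: measurable_rule_def)
    ultimately have "(\<lambda>v. t j (restrict v {1..j})) \<in> borel_measurable (PiM ({1..i} \<union> {i<..k}) D)"
      by (rule measurable_compose)
    from measurable_compose[OF measurable_merge this] show ?thesis .
  qed
  then show ?thesis by (simp add: case_prod_beta')
qed

lemma measurable_expected_later: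
  assumes "measurable_rule t" "i \<le> k"
  shows "expected_later t i \<in> borel_measurable (PiM {1..i} D)"
proof -
  interpret prob_space "PiM {i<..k} D" by (intro prob_space_histories) auto
  show ?thesis
    unfolding expected_later_def[abs_def]
    using measurable_sum_later[OF assms] by (rule borel_measurable_nn_integral)
qed

lemma expected_later_k: "expected_later t k h = 0"
  by (simp add: expected_later_def)

text \<open>Tonelli with the value of day \<open>Suc i\<close> as the outer variable. The first
  summand depends only on the extended history and leaves the inner integral over a probability
  measure.\<close>

lemma expected_later_step:
  assumes t: "measurable_rule t" and i: "i < k" and h: "h \<in> space (PiM {1..i} D)"
  shows "expected_later t i h =
    (\<integral>\<^sup>+ v. ennreal (t (Suc i) (h(Suc i := v))) + expected_later t (Suc i) (h(Suc i := v)) \<partial>D (Suc i))"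
proof -
  have ins: "{i<..k} = insert (Suc i) {Suc i<..k}" using i by auto
  interpret prob_space "PiM {Suc i<..k} D" by (intro prob_space_histories) auto
  let ?F = "\<lambda>i h w. \<Sum>j\<in>{i<..k}. ennreal (t j (restrict (merge {1..i} {i<..k} (h, w)) {1..j}))"
  have meas: "?F i h \<in> borel_measurable (PiM {i<..k} D)" if "i \<le> k" "h \<in> space (PiM {1..i} D)" for i h
    using measurable_compose_Pair1[OF that(2) measurable_sum_later[OF t that(1)]] by simp
  have "?F i h \<in> borel_measurable (PiM (insert (Suc i) {Suc i<..k}) D)"
    using meas[of i h] i h unfolding ins[symmetric] by simp
  then have "(\<integral>\<^sup>+ w. ?F i h w \<partial>PiM (insert (Suc i) {Suc i<..k}) D) =
      (\<integral>\<^sup>+ v. (\<integral>\<^sup>+ w. ?F i h (w(Suc i := v)) \<partial>PiM {Suc i<..k} D) \<partial>D (Suc i))"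
    using i by (intro nn_integral_PiM_insert) auto
  then have "expected_later t i h = (\<integral>\<^sup>+ v. (\<integral>\<^sup>+ w. ?F i h (w(Suc i := v)) \<partial>PiM {Suc i<..k} D) \<partial>D (Suc i))"
    unfolding expected_later_def ins[symmetric] .
  also have "\<dots> = (\<integral>\<^sup>+ v. ennreal (t (Suc i) (h(Suc i := v))) + expected_later t (Suc i) (h(Suc i := v)) \<partial>D (Suc i))"
  proof (intro nn_integral_cong)
    fix v assume v: "v \<in> space (D (Suc i))"
    note h' = extend_history[OF h v]
    have "?F i h (w(Suc i := v)) = ennreal (t (Suc i) (h(Suc i := v))) + ?F (Suc i) (h(Suc i := v)) w" for w
    proof -
      \<comment> \<open>The value \<open>v\<close> moves from the later values to the reported
        history.\<close>
      have m: "merge {1..i} {i<..k} (h, w(Suc i := v)) = merge {1..Suc i} {Suc i<..k} (h(Suc i := v), w)"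
        using i by (auto simp: merge_def fun_eq_iff)
      have r: "restrict (merge {1..Suc i} {Suc i<..k} (h(Suc i := v), w)) {1..Suc i} = h(Suc i := v)"
        using h' by (auto simp: merge_def fun_eq_iff space_PiM PiE_def extensional_def)
      show ?thesis
        unfolding m by (subst ins, subst sum.insert) (simp_all only: r finite_greaterThanAtMost greaterThanAtMost_iff, simp)
    qed
    then show "(\<integral>\<^sup>+ w. ?F i h (w(Suc i := v)) \<partial>PiM {Suc i<..k} D) =
        ennreal (t (Suc i) (h(Suc i := v))) + expected_later t (Suc i) (h(Suc i := v))"
      using meas[OF _ h'] i
      by (simp add: nn_integral_add emeasure_space_1 expected_later_def)
  qed
  finally show ?thesis .
qed

section \<open>Daily surplus and utility, and revenue as their difference\<close>

definition day_surplus :: "rule \<Rightarrow> rule" where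
  "day_surplus x j v = v j * x j v"

definition day_utility :: "rule \<Rightarrow> rule \<Rightarrow> rule" where
  "day_utility x p j v = v j * x j v - p j v"

lemma measurable_value:
  assumes "j \<in> {1..n}" "n \<le> k"
  shows "(\<lambda>v. v j) \<in> borel_measurable (PiM {1..n} D)"
proof -
  interpret value_space "D j" "lo j" "hi j" using assms by (intro day) auto
  show ?thesis
    using measurable_component_singleton[OF assms(1), of D] id_measurable
    by (rule measurable_compose)
qed

lemma measurable_day_rules:
  assumes "is_mechanism k D x p"
  shows "measurable_rule (day_surplus x)" "measurable_rule (day_utility x p)"
proof -
  have meas: "x j \<in> borel_measurable (PiM {1..j} D)" "p j \<in> borel_measurable (PiM {1..j} D)"
      "(\<lambda>v. v j) \<in> borel_measurable (PiM {1..j} D)" if "j \<in> {1..k}" for j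
    using assms that measurable_value[of j j] by (auto simp: is_mechanism_def)
  show "measurable_rule (day_surplus x)" "measurable_rule (day_utility x p)"
    unfolding measurable_rule_def day_surplus_def[abs_def] day_utility_def[abs_def]
    by (intro ballI borel_measurable_times borel_measurable_diff meas; assumption)+
qed

lemma day_surplus_bounds:
  assumes "is_mechanism k D x p" "j \<in> {1..k}" "v \<in> space (PiM {1..j} D)"
  shows "0 \<le> day_surplus x j v" "day_surplus x j v \<le> hi j"
proof -
  interpret value_space "D j" "lo j" "hi j" using assms by (intro day)
  have "v j \<in> space (D j)" using assms by (auto simp: space_PiM)
  then have "0 \<le> v j" "v j \<le> hi j" using space_nonneg space_eq by auto
  moreover have "0 \<le> x j v" "x j v \<le> 1" using assms by (auto simp: is_mechanism_def)
  ultimately show "0 \<le> day_surplus x j v" "day_surplus x j v \<le> hi j"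
    using mult_mono[of "v j" "hi j" "x j v" 1] by (auto simp: day_surplus_def)
qed

lemma day_utility_nonneg:
  assumes "ex_post_IR k D x p" "j \<in> {1..k}" "v \<in> space (PiM {1..j} D)"
  shows "0 \<le> day_utility x p j v"
  using assms by (auto simp: ex_post_IR_def day_utility_def)

text \<open>Individual rationality makes all later utilities nonnegative, so the signed expectation
  has no negative part.\<close>

lemma continuation_utility_eq:
  assumes IR: "ex_post_IR k D x p" and i: "i \<le> k" and h: "h \<in> space (PiM {1..i} D)"
  shows "continuation_utility k D x p i h = enn2ereal (expected_later (day_utility x p) i h)"
proof -
  let ?r = "\<lambda>w j. restrict (merge {1..i} {i<..k} (h, w)) {1..j}"
  have nonneg: "0 \<le> day_utility x p j (?r w j)" if "w \<in> space (PiM {i<..k} D)" "j \<in> {i<..k}" for w j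
    using that merge_history[OF h that(1) i]
    by (intro day_utility_nonneg[OF IR] restrict_history[of _ k]) auto
  have "continuation_utility k D x p i h =
      ereal_expectation (PiM {i<..k} D) (\<lambda>w. ereal (\<Sum>j\<in>{i<..k}. day_utility x p j (?r w j)))"
    unfolding continuation_utility_def day_utility_def
    by (intro ereal_expectation_cong arg_cong[where f = ereal] sum.cong)
      (auto simp: merge_def)
  also have "\<dots> = enn2ereal (expected_later (day_utility x p) i h)"
    using nonneg unfolding expected_later_def
    by (subst ereal_expectation_nonneg_eq)
      (auto intro!: sum_nonneg arg_cong[where f = enn2ereal] nn_integral_cong sum_ennreal[symmetric])
  finally show ?thesis .
qed

lemma expected_surplus_finite:
  assumes "is_mechanism k D x p" "i \<le> k" "h \<in> space (PiM {1..i} D)"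
  shows "expected_later (day_surplus x) i h \<noteq> \<top>"
proof -
  interpret prob_space "PiM {i<..k} D" by (intro prob_space_histories) auto
  have "expected_later (day_surplus x) i h \<le> (\<integral>\<^sup>+ w. (\<Sum>j\<in>{i<..k}. ennreal (hi j)) \<partial>PiM {i<..k} D)"
    unfolding expected_later_def
    by (intro nn_integral_mono sum_mono ennreal_leI day_surplus_bounds[OF assms(1)]
        restrict_history[of _ k] merge_history assms) auto
  then show ?thesis by (auto simp: emeasure_space_1 top_unique)
qed

lemma empty_history: "(\<lambda>_. undefined) \<in> space (PiM {1..0} D)"
  by (simp add: space_PiM)

lemma expected_later_0:
  "expected_later t 0 h = (\<integral>\<^sup>+ w. (\<Sum>j=1..k. ennreal (t j (restrict w {1..j}))) \<partial>PiM {1..k} D)"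
proof -
  have "{0<..k} = {1..k}" by auto
  moreover have "restrict (merge {1..0} {1..k} (h, w)) {1..j} = restrict w {1..j}" if "j \<in> {1..k}" for w j
    using that by (auto simp: merge_def fun_eq_iff)
  ultimately show ?thesis
    unfolding expected_later_def by (auto intro!: nn_integral_cong sum.cong)
qed

text \<open>Each payment is surplus minus utility. Surplus is bounded by the upper ends
  \<open>hi j\<close>, so the expectation splits even when the expected utility is infinite.\<close>

lemma revenue_eq:
  assumes mech: "is_mechanism k D x p" and IR: "ex_post_IR k D x p"
  shows "revenue k D p = enn2ereal (expected_later (day_surplus x) 0 (\<lambda>_. undefined))
    - enn2ereal (expected_later (day_utility x p) 0 (\<lambda>_. undefined))"
proof -
  have meas: "(\<lambda>w. \<Sum>j=1..k. ennreal (t j (restrict w {1..j}))) \<in> borel_measurable (PiM {1..k} D)"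
    if "measurable_rule t" for t
    by (intro borel_measurable_sum measurable_compose[OF _ measurable_ennreal]
        measurable_compose[OF measurable_restrict_subset])
      (use that in \<open>auto simp: measurable_rule_def\<close>)
  have nonneg: "0 \<le> day_surplus x j (restrict w {1..j})" "0 \<le> day_utility x p j (restrict w {1..j})"
    if "w \<in> space (PiM {1..k} D)" "j \<in> {1..k}" for w j
    using that by (intro day_surplus_bounds[OF mech] day_utility_nonneg[OF IR] restrict_history[of _ k]; simp)+
  have "revenue k D p = ereal_expectation (PiM {1..k} D) (\<lambda>w.
      enn2ereal (\<Sum>j=1..k. ennreal (day_surplus x j (restrict w {1..j})))
      - enn2ereal (\<Sum>j=1..k. ennreal (day_utility x p j (restrict w {1..j}))))"
    unfolding revenue_def
  proof (rule ereal_expectation_cong)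
    fix w assume "w \<in> space (PiM {1..k} D)"
    note nn = nonneg[OF this]
    have "(\<Sum>j=1..k. ennreal (day_surplus x j (restrict w {1..j}))) =
        ennreal (\<Sum>j=1..k. day_surplus x j (restrict w {1..j}))"
      "(\<Sum>j=1..k. ennreal (day_utility x p j (restrict w {1..j}))) =
        ennreal (\<Sum>j=1..k. day_utility x p j (restrict w {1..j}))"
      using nn by (simp_all only: sum_ennreal)
    moreover have "(\<Sum>j=1..k. p j (restrict w {1..j})) =
        (\<Sum>j=1..k. day_surplus x j (restrict w {1..j})) - (\<Sum>j=1..k. day_utility x p j (restrict w {1..j}))"
      by (simp add: day_surplus_def day_utility_def flip: sum_subtractf)
    moreover have "0 \<le> (\<Sum>j=1..k. day_surplus x j (restrict w {1..j}))"
      "0 \<le> (\<Sum>j=1..k. day_utility x p j (restrict w {1..j}))"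
      using nn by (intro sum_nonneg; simp)+
    ultimately show "ereal (\<Sum>i=1..k. p i (restrict w {1..i})) =
      enn2ereal (\<Sum>j=1..k. ennreal (day_surplus x j (restrict w {1..j})))
      - enn2ereal (\<Sum>j=1..k. ennreal (day_utility x p j (restrict w {1..j})))"
      by (simp add: enn2ereal_ennreal)
  qed
  also have "\<dots> = enn2ereal (expected_later (day_surplus x) 0 (\<lambda>_. undefined))
    - enn2ereal (expected_later (day_utility x p) 0 (\<lambda>_. undefined))"
    using expected_surplus_finite[OF mech _ empty_history]
    unfolding expected_later_0
    by (intro ereal_expectation_diff meas measurable_day_rules[OF mech]) auto
  finally show ?thesis .
qed

section \<open>Cumulative tradeoff functions\<close>

text \<open>The coefficient \<open>d\<close> for day \<open>Suc i\<close>, so index 0 stands for day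
  1. It lets the first day and the later days share their lemmas.\<close>

definition first_day :: "nat \<Rightarrow> real" where
  "first_day i = (if i = 0 then 1 else 0)"

lemma first_day_nonneg: "0 \<le> first_day i"
  by (simp add: first_day_def)

lemma day_tradeoff_Suc:
  "day_tradeoff k D (Suc i) = (\<lambda>u. ghat k D (Suc (Suc i)) u - ereal (first_day i * u))"
  by (auto simp: day_tradeoff_def first_day_def fun_eq_iff numeral_2_eq_2 zero_ereal_def[symmetric])

lemma ghat_after_last: "ghat k D (Suc k) c = (if c \<ge> 0 then 0 else - \<infinity>)"
  by (subst ghat.simps) simp

text \<open>Backward induction from day \<open>Suc k\<close>. It stops at \<open>ghat k D 2\<close>,
  because day 1 subtracts utility and its value need not be monotone in the level.\<close>

lemma tradeoff_function_ghat:
  assumes "1 \<le> i" "i \<le> k"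
  shows "tradeoff_function (ghat k D (Suc i))"
  using assms(2,1)
proof (induction i rule: inc_induct)
  case base
  show ?case
    by (auto simp: tradeoff_function_def ghat_after_last mono_def intro!: exI[of _ 0])
next
  case (step i)
  interpret value_space "D (Suc i)" "lo (Suc i)" "hi (Suc i)" using step by (intro day) auto
  have "ghat k D (Suc i) = (\<lambda>c. tight_value (D (Suc i)) c (ghat k D (Suc (Suc i))))"
    using step.hyps step.prems
    by (auto simp: ghat_eq_tight_value day_tradeoff_Suc first_day_def zero_ereal_def[symmetric] fun_eq_iff)
  then show ?case
    using tradeoff_function_tight_value[of "ghat k D (Suc (Suc i))"] step by simp
qed

lemma tight_objective_le_ghat:
  assumes "i < k" "tight_feasible (D (Suc i)) c x p"
  shows "tight_objective (D (Suc i)) (day_tradeoff k D (Suc i)) x p \<le> ghat k D (Suc i) c"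
  using assms
  by (auto simp: ghat_eq_tight_value tight_value_def intro!: SUP_upper2[of "(x, p)"])

lemma stage_value_le_ghat:
  assumes i: "i < k" and feas: "tight_feasible (D (Suc i)) c x p"
    and u: "\<And>v. v \<in> space (D (Suc i)) \<Longrightarrow> 0 \<le> v * x v - p v"
  shows "enn2ereal (value_space.stage_value (D (Suc i)) (ghat k D (Suc (Suc i))) x p) - ereal (first_day i * c)
    \<le> ghat k D (Suc i) c"
proof -
  interpret value_space "D (Suc i)" "lo (Suc i)" "hi (Suc i)" using i by (intro day) auto
  have "tradeoff_function (ghat k D (Suc (Suc i)))"
    using i by (intro tradeoff_function_ghat) auto
  from tight_objective_nonneg_utility[OF this feas first_day_nonneg u]
  show ?thesis
    using tight_objective_le_ghat[OF i feas] by (simp add: day_tradeoff_Suc)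
qed

text \<open>Witnessed by selling nothing and paying out \<open>c\<close>. On the first day this
  transfer costs \<open>c\<close>, hence the side condition.\<close>

lemma ghat_nonneg:
  assumes "i < k" "0 \<le> c" "0 < i \<or> c = 0"
  shows "0 \<le> ghat k D (Suc i) c"
proof -
  interpret value_space "D (Suc i)" "lo (Suc i)" "hi (Suc i)" using assms by (intro day) auto
  have "tight_feasible (D (Suc i)) c (\<lambda>_. 0) (\<lambda>_. - c)"
    using prob_space by (auto simp: tight_feasible_def has_bochner_integral_iff)
  from stage_value_le_ghat[OF assms(1) this] assms(2)
  have "enn2ereal (stage_value (ghat k D (Suc (Suc i))) (\<lambda>_. 0) (\<lambda>_. - c)) - ereal (first_day i * c)
      \<le> ghat k D (Suc i) c" by simp
  moreover have "first_day i * c = 0" using assms(3) by (auto simp: first_day_def)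
  ultimately show ?thesis
    by (metis enn2ereal_nonneg ereal_minus(7) order_trans zero_ereal_def)
qed

section \<open>The upper bound\<close>

text \<open>A finite total utility alone gives finiteness only after almost every history. Periodic
  incentive compatibility extends it to every history, so that subtracting the continuation from a
  payment always gives a real number.\<close>

lemma later_utility_finite:
  assumes mech: "feasible_mechanism k D x p"
    and fin: "expected_later (day_utility x p) 0 (\<lambda>_. undefined) \<noteq> \<top>"
    and "i \<le> k" "h \<in> space (PiM {1..i} D)"
  shows "expected_later (day_utility x p) i h \<noteq> \<top>"
  using assms(3,4)
proof (induction i arbitrary: h)
  case 0
  then have "h = (\<lambda>_. undefined)" by (simp add: space_PiM)
  with fin show ?case by simp
next
  case (Suc i)
  interpret value_space "D (Suc i)" "lo (Suc i)" "hi (Suc i)" using Suc by (intro day) auto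
  have IC: "periodic_IC k D x p" and IR: "ex_post_IR k D x p" and mec: "is_mechanism k D x p"
    using mech by (auto simp: feasible_mechanism_def)
  obtain h0 v' where h0: "h0 \<in> space (PiM {1..i} D)" "v' \<in> space (D (Suc i))" "h = h0(Suc i := v')"
    using history_cases[OF Suc.prems(2)] .
  show ?case
  proof
    assume inf: "expected_later (day_utility x p) (Suc i) h = \<top>"
    \<comment> \<open>Reporting \<open>v'\<close> would then be infinitely profitable for every type, so every type has
      infinite utility.\<close>
    have "ennreal (day_utility x p (Suc i) (h0(Suc i := v)))
        + expected_later (day_utility x p) (Suc i) (h0(Suc i := v)) = \<top>"
      if v: "v \<in> space (D (Suc i))" for v
    proof -
      note h1 = extend_history[OF h0(1) v]
      have "\<infinity> \<le> ereal (day_utility x p (Suc i) (h0(Suc i := v)))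
          + enn2ereal (expected_later (day_utility x p) (Suc i) (h0(Suc i := v)))"
        using IC[unfolded periodic_IC_def, rule_format, OF _ h1 h0(2)] Suc.prems(1) inf[unfolded h0(3)]
          continuation_utility_eq[OF IR Suc.prems(1) h1]
          continuation_utility_eq[OF IR Suc.prems(1) extend_history[OF h0(1,2)]]
        by (simp add: day_utility_def del: fun_upd_apply)
      then show ?thesis
        by (cases "expected_later (day_utility x p) (Suc i) (h0(Suc i := v))")
          (auto simp: enn2ereal_ennreal)
    qed
    then have "expected_later (day_utility x p) i h0 = (\<integral>\<^sup>+ v. \<top> \<partial>D (Suc i))"
      using Suc.prems(1) expected_later_step[OF measurable_day_rules(2)[OF mec] _ h0(1)]
      by (simp cong: nn_integral_cong_simp del: nn_integral_const fun_upd_apply)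
    also have "\<dots> = \<top>" by (simp add: emeasure_space_1)
    finally show False using Suc.IH[OF _ h0(1)] Suc.prems by simp
  qed
qed

text \<open>The expected later utility is treated as a rebate on the payment of day
  \<open>Suc i\<close>. Periodic incentive compatibility then becomes the single-day condition, and
  the recursion for expected utility becomes tightness.\<close>

lemma continuation_tight_feasible:
  assumes mech: "feasible_mechanism k D x p"
    and fin: "expected_later (day_utility x p) 0 (\<lambda>_. undefined) \<noteq> \<top>"
    and i: "i < k" and h: "h \<in> space (PiM {1..i} D)"
  shows "tight_feasible (D (Suc i)) (enn2real (expected_later (day_utility x p) i h))
    (\<lambda>v. x (Suc i) (h(Suc i := v)))
    (\<lambda>v. p (Suc i) (h(Suc i := v)) - enn2real (expected_later (day_utility x p) (Suc i) (h(Suc i := v))))"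
    (is "tight_feasible _ ?c ?x ?p")
proof -
  interpret value_space "D (Suc i)" "lo (Suc i)" "hi (Suc i)" using i by (intro day) auto
  have IC: "periodic_IC k D x p" and IR: "ex_post_IR k D x p" and mec: "is_mechanism k D x p"
    using mech by (auto simp: feasible_mechanism_def)
  define U where "U v = expected_later (day_utility x p) (Suc i) (h(Suc i := v))" for v
  define T where "T v = day_utility x p (Suc i) (h(Suc i := v))" for v
  have U_fin: "U v = ennreal (enn2real (U v))" if "v \<in> space (D (Suc i))" for v
    using later_utility_finite[OF mech fin, of "Suc i"] extend_history[OF h that] i
    by (simp add: U_def less_top[symmetric])
  have T_nonneg: "0 \<le> T v" if "v \<in> space (D (Suc i))" for v
    using day_utility_nonneg[OF IR _ extend_history[OF h that]] i by (simp add: T_def)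
  note ext = measurable_extend_history[OF h]
  have [measurable]: "U \<in> borel_measurable (D (Suc i))"
    unfolding U_def[abs_def] using i
    by (intro measurable_compose[OF ext measurable_expected_later] measurable_day_rules[OF mec]) auto
  have [measurable]: "?x \<in> borel_measurable (D (Suc i))" "(\<lambda>v. p (Suc i) (h(Suc i := v))) \<in> borel_measurable (D (Suc i))"
    using mec i by (auto intro!: measurable_compose[OF ext] simp: is_mechanism_def)
  have u: "v * ?x v - ?p v = T v + enn2real (U v)" for v
    by (simp add: T_def U_def day_utility_def)
  have meas: "(\<lambda>v. v * ?x v - ?p v) \<in> borel_measurable (D (Suc i))"
    unfolding U_def[symmetric] by measurable
  show ?thesis
    unfolding tight_feasible_def
  proof (intro conjI ballI)
    show "?p \<in> borel_measurable (D (Suc i))"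
      unfolding U_def[symmetric] by measurable
    show "?x v \<in> {0..1}" if "v \<in> space (D (Suc i))" for v
      using mec i extend_history[OF h that] by (auto simp: is_mechanism_def)
    show "v * ?x v' - ?p v' \<le> v * ?x v - ?p v"
      if v: "v \<in> space (D (Suc i))" "v' \<in> space (D (Suc i))" for v v'
    proof -
      note h1 = extend_history[OF h v(1)] and h2 = extend_history[OF h v(2)]
      have "ereal (v * ?x v' - p (Suc i) (h(Suc i := v'))) + enn2ereal (U v')
          \<le> ereal (v * ?x v - p (Suc i) (h(Suc i := v))) + enn2ereal (U v)"
        using IC[unfolded periodic_IC_def, rule_format, OF _ h1 v(2)] i
          continuation_utility_eq[OF IR _ h1] continuation_utility_eq[OF IR _ h2]
        by (simp add: U_def)
      moreover have "enn2ereal (U w) = ereal (enn2real (U w))" if "w \<in> space (D (Suc i))" for w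
        by (subst U_fin[OF that]) (simp add: enn2ereal_ennreal)
      ultimately show ?thesis using v by (simp add: U_def)
    qed
    have "(\<integral>\<^sup>+ v. ennreal (v * ?x v - ?p v) \<partial>D (Suc i)) = (\<integral>\<^sup>+ v. ennreal (T v) + U v \<partial>D (Suc i))"
    proof (intro nn_integral_cong)
      fix v assume v: "v \<in> space (D (Suc i))"
      show "ennreal (v * ?x v - ?p v) = ennreal (T v) + U v"
        unfolding u using T_nonneg[OF v] by (subst (2) U_fin[OF v]) simp
    qed
    also have "\<dots> = expected_later (day_utility x p) i h"
      unfolding U_def T_def using expected_later_step[OF measurable_day_rules(2)[OF mec] i h] by simp
    also have "\<dots> = ennreal ?c"
      using later_utility_finite[OF mech fin _ h] i by (simp add: less_top[symmetric])
    finally show "has_bochner_integral (D (Suc i)) (\<lambda>v. v * ?x v - ?p v) ?c"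
      using T_nonneg by (intro has_bochner_integral_nn_integral meas AE_I2) (auto simp: u)
  qed fact
qed

text \<open>The induction step of the upper bound, stated for the first day as well through
  \<open>first_day\<close>. Given the bound for later surplus, the single-day mechanism with the
  rebate competes in the problem defining \<open>ghat k D (Suc i)\<close>.\<close>

lemma later_surplus_le_stage_value:
  assumes mech: "feasible_mechanism k D x p"
    and fin: "expected_later (day_utility x p) 0 (\<lambda>_. undefined) \<noteq> \<top>"
    and i: "i < k" and h: "h \<in> space (PiM {1..i} D)"
    and later: "\<And>h. h \<in> space (PiM {1..Suc i} D) \<Longrightarrow> expected_later (day_surplus x) (Suc i) h
      \<le> e2ennreal (ghat k D (Suc (Suc i)) (enn2real (expected_later (day_utility x p) (Suc i) h)))"
  shows "enn2ereal (expected_later (day_surplus x) i h)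
      - ereal (first_day i * enn2real (expected_later (day_utility x p) i h))
    \<le> ghat k D (Suc i) (enn2real (expected_later (day_utility x p) i h))"
proof -
  interpret value_space "D (Suc i)" "lo (Suc i)" "hi (Suc i)" using i by (intro day) auto
  have IR: "ex_post_IR k D x p" and mec: "is_mechanism k D x p"
    using mech by (auto simp: feasible_mechanism_def)
  define U where "U v = expected_later (day_utility x p) (Suc i) (h(Suc i := v))" for v
  define x' where "x' v = x (Suc i) (h(Suc i := v))" for v
  define p' where "p' v = p (Suc i) (h(Suc i := v)) - enn2real (U v)" for v
  let ?g = "ghat k D (Suc (Suc i))"
  have "tradeoff_function ?g" using i by (intro tradeoff_function_ghat) auto
  then have mono: "mono ?g" by (auto simp: tradeoff_function_def)
  have feas: "tight_feasible (D (Suc i)) (enn2real (expected_later (day_utility x p) i h)) x' p'"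
    using continuation_tight_feasible[OF mech fin i h] unfolding x'_def p'_def U_def .
  \<comment> \<open>Individual rationality of day \<open>Suc i\<close>: total utility is at least
    the continuation part, so by monotonicity the tradeoff function may be evaluated at the
    total.\<close>
  have u: "enn2real (U v) \<le> v * x' v - p' v" if "v \<in> space (D (Suc i))" for v
    using day_utility_nonneg[OF IR _ extend_history[OF h that]] i
    by (simp add: x'_def p'_def day_utility_def)
  have "expected_later (day_surplus x) i h =
    (\<integral>\<^sup>+ v. ennreal (v * x' v) + expected_later (day_surplus x) (Suc i) (h(Suc i := v)) \<partial>D (Suc i))"
    using expected_later_step[OF measurable_day_rules(1)[OF mec] i h] by (simp add: x'_def day_surplus_def)
  also have "\<dots> \<le> stage_value ?g x' p'"
    unfolding stage_value_def
  proof (intro nn_integral_mono add_left_mono)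
    fix v assume v: "v \<in> space (D (Suc i))"
    have "expected_later (day_surplus x) (Suc i) (h(Suc i := v)) \<le> e2ennreal (?g (enn2real (U v)))"
      using later[OF extend_history[OF h v]] by (simp add: U_def)
    also have "\<dots> \<le> e2ennreal (?g (v * x' v - p' v))"
      using mono u[OF v] by (intro e2ennreal_mono) (auto simp: mono_def)
    finally show "expected_later (day_surplus x) (Suc i) (h(Suc i := v)) \<le> e2ennreal (?g (v * x' v - p' v))" .
  qed
  finally have "enn2ereal (expected_later (day_surplus x) i h) \<le> enn2ereal (stage_value ?g x' p')"
    by (simp add: less_eq_ennreal.rep_eq)
  then have "enn2ereal (expected_later (day_surplus x) i h)
      - ereal (first_day i * enn2real (expected_later (day_utility x p) i h)) \<le> enn2ereal (stage_value ?g x' p')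
      - ereal (first_day i * enn2real (expected_later (day_utility x p) i h))"
    by (intro ereal_minus_mono) auto
  also have "\<dots> \<le> ghat k D (Suc i) (enn2real (expected_later (day_utility x p) i h))"
    using u by (intro stage_value_le_ghat[OF i feas]) (meson enn2real_nonneg order_trans)
  finally show ?thesis .
qed

lemma later_surplus_le_ghat:
  assumes mech: "feasible_mechanism k D x p"
    and fin: "expected_later (day_utility x p) 0 (\<lambda>_. undefined) \<noteq> \<top>"
    and "1 \<le> i" "i \<le> k" "h \<in> space (PiM {1..i} D)"
  shows "expected_later (day_surplus x) i h
    \<le> e2ennreal (ghat k D (Suc i) (enn2real (expected_later (day_utility x p) i h)))"
  using assms(4,3,5)
proof (induction i arbitrary: h rule: inc_induct)
  case base
  then show ?case by (simp add: expected_later_k)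
next
  case (step i)
  have "enn2ereal (expected_later (day_surplus x) i h)
    \<le> ghat k D (Suc i) (enn2real (expected_later (day_utility x p) i h))"
    using later_surplus_le_stage_value[OF mech fin \<open>i < k\<close> step.prems(2) step.IH] step.prems(1)
    by (simp add: first_day_def zero_ereal_def[symmetric])
  from e2ennreal_mono[OF this] show ?case by simp
qed

lemma revenue_le_ghat:
  assumes mech: "feasible_mechanism k D x p" and "1 \<le> k"
  obtains c where "revenue k D p \<le> ghat k D 1 c"
proof -
  have IR: "ex_post_IR k D x p" and mec: "is_mechanism k D x p"
    using mech by (auto simp: feasible_mechanism_def)
  let ?S = "expected_later (day_surplus x) 0 (\<lambda>_. undefined)"
  let ?U = "expected_later (day_utility x p) 0 (\<lambda>_. undefined)"
  have rev: "revenue k D p = enn2ereal ?S - enn2ereal ?U"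
    by (rule revenue_eq[OF mec IR])
  show thesis
  proof (cases "?U = \<top>")
    case True
    then have "revenue k D p = - \<infinity>"
      using expected_surplus_finite[OF mec _ empty_history] unfolding rev
      by (cases ?S) (auto simp: enn2ereal_ennreal)
    \<comment> \<open>Infinite expected utility means revenue minus infinity, so any level
      serves.\<close>
    then show thesis by (intro that[of 0]) simp
  next
    case False
    have "revenue k D p = enn2ereal ?S - ereal (first_day 0 * enn2real ?U)"
      unfolding rev using False by (cases ?U) (auto simp: enn2ereal_ennreal first_day_def)
    also have "\<dots> \<le> ghat k D (Suc 0) (enn2real ?U)"
      using \<open>1 \<le> k\<close>
      by (intro later_surplus_le_stage_value[OF mech False _ empty_history] later_surplus_le_ghat[OF mech False]) auto
    finally show thesis by (intro that) simp
  qed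
qed

end

section \<open>Attainment by the composed mechanism\<close>

lemma utility_level_cong:
  "(\<And>j. j \<in> {1..i} \<Longrightarrow> h j = h' j) \<Longrightarrow> utility_level X P c0 i h = utility_level X P c0 i h'"
  by (induction i) auto

lemma utility_level_upd [simp]:
  "i < j \<Longrightarrow> utility_level X P c0 i (h(j := v)) = utility_level X P c0 i h"
  by (intro utility_level_cong) auto

lemma composed_allocation_Suc:
  "composed_allocation X P c0 (Suc i) (h(Suc i := v)) = X (Suc i) (utility_level X P c0 i h) v"
  by (simp add: composed_allocation_def)

locale optimal_composition = value_sequence +
  fixes X P :: "nat \<Rightarrow> real \<Rightarrow> real \<Rightarrow> real" and c0 :: real
  assumes k_pos: "k \<ge> 1"
    and XP_optimal: "\<And>i c. i \<in> {1..k} \<Longrightarrow> tight_optimal (D i) c (day_tradeoff k D i) (X i c) (P i c)"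
    and X_measurable: "\<And>i. i \<in> {1..k} \<Longrightarrow> (\<lambda>(c, v). X i c v) \<in> borel_measurable (borel \<Otimes>\<^sub>M D i)"
    and P_measurable: "\<And>i. i \<in> {1..k} \<Longrightarrow> (\<lambda>(c, v). P i c v) \<in> borel_measurable (borel \<Otimes>\<^sub>M D i)"
    and c0_maximizer: "\<And>c. ghat k D 1 c \<le> ghat k D 1 c0"
begin

abbreviation level :: "nat \<Rightarrow> (nat \<Rightarrow> real) \<Rightarrow> real" where
  "level \<equiv> utility_level X P c0"

abbreviation alloc :: rule where
  "alloc \<equiv> composed_allocation X P c0"

abbreviation pay :: rule where
  "pay \<equiv> composed_payment k X P c0"

section \<open>Nonnegativity of the promised utility levels\<close>

lemma XP_feasible: "i < k \<Longrightarrow> tight_feasible (D (Suc i)) c (X (Suc i) c) (P (Suc i) c)"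
  using XP_optimal[of "Suc i" c] by (simp add: tight_optimal_def)

lemma ghat_eq_objective:
  assumes "i < k"
  shows "ghat k D (Suc i) c = tight_objective (D (Suc i)) (day_tradeoff k D (Suc i)) (X (Suc i) c) (P (Suc i) c)"
proof (rule antisym)
  show "ghat k D (Suc i) c \<le> tight_objective (D (Suc i)) (day_tradeoff k D (Suc i)) (X (Suc i) c) (P (Suc i) c)"
    using XP_optimal[of "Suc i" c] assms
    by (auto simp: ghat_eq_tight_value tight_value_def tight_optimal_def intro!: SUP_least)
qed (use tight_objective_le_ghat[OF assms XP_feasible[OF assms]] in simp)

lemma optimal_utility_nonneg:
  assumes i: "i < k" and c: "0 \<le> ghat k D (Suc i) c" and v: "v \<in> space (D (Suc i))"
  shows "0 \<le> v * X (Suc i) c v - P (Suc i) c v"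
proof (rule ccontr)
  interpret value_space "D (Suc i)" "lo (Suc i)" "hi (Suc i)" using i by (intro day) auto
  assume "\<not> ?thesis"
  then have neg: "v * X (Suc i) c v - P (Suc i) c v < 0" by simp
  have "tradeoff_function (ghat k D (Suc (Suc i)))"
    using i by (intro tradeoff_function_ghat) auto
  from tight_objective_negative_utility[OF this XP_feasible[OF i] first_day_nonneg v neg]
  have "ghat k D (Suc i) c = - \<infinity>"
    unfolding ghat_eq_objective[OF i] day_tradeoff_Suc .
  with c show False by simp
qed

lemma ghat_c0_nonneg: "0 \<le> ghat k D (Suc 0) c0"
  using ghat_nonneg[of 0 0] c0_maximizer[of 0] k_pos by (simp add: order_trans)

text \<open>The induction carries the sign of \<open>ghat\<close> and not of the level: a value
  above minus infinity makes the utility of every type nonnegative, this utility is the next level,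
  and a nonnegative level after day 1 again has a nonnegative value.\<close>

lemma ghat_level_nonneg:
  assumes "i < k" "h \<in> space (PiM {1..i} D)"
  shows "0 \<le> ghat k D (Suc i) (level i h)"
  using assms
proof (induction i arbitrary: h)
  case 0
  show ?case using ghat_c0_nonneg by simp
next
  case (Suc i)
  obtain h0 v where h0: "h0 \<in> space (PiM {1..i} D)" "v \<in> space (D (Suc i))" "h = h0(Suc i := v)"
    using history_cases[OF Suc.prems(2)] .
  have "0 \<le> level (Suc i) h"
    using optimal_utility_nonneg[OF _ Suc.IH[OF _ h0(1)] h0(2)] Suc.prems(1) by (simp add: h0(3))
  then show ?case using Suc.prems(1) by (intro ghat_nonneg) auto
qed

lemma level_Suc_nonneg:
  assumes "i < k" "h \<in> space (PiM {1..i} D)" "v \<in> space (D (Suc i))"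
  shows "0 \<le> v * X (Suc i) (level i h) v - P (Suc i) (level i h) v"
  using optimal_utility_nonneg[OF assms(1) ghat_level_nonneg[OF assms(1,2)] assms(3)] .

lemma level_nonneg:
  assumes "1 \<le> i" "i \<le> k" "h \<in> space (PiM {1..i} D)"
  shows "0 \<le> level i h"
proof -
  obtain j where j: "i = Suc j" using assms(1) by (cases i) auto
  obtain h0 v where h0: "h0 \<in> space (PiM {1..j} D)" "v \<in> space (D (Suc j))" "h = h0(Suc j := v)"
    using history_cases[OF assms(3)[unfolded j]] .
  show ?thesis
    using level_Suc_nonneg[OF _ h0(1,2)] assms(2) by (simp add: j h0(3))
qed

text \<open>Before day \<open>k\<close> the buyer pays the full value of the allocation; the
  promised utility is delivered only on day \<open>k\<close>.\<close>

lemma day_utility_composed: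
  assumes "1 \<le> j" "j \<le> k"
  shows "day_utility alloc pay j v = (if j < k then 0 else level j v)"
  using assms by (cases j) (auto simp: day_utility_def composed_allocation_def composed_payment_def)

lemma composed_ex_post_IR: "ex_post_IR k D alloc pay"
  using day_utility_composed level_nonneg by (auto simp: ex_post_IR_def day_utility_def[symmetric])

section \<open>Feasibility of the composed mechanism\<close>

lemma measurable_level:
  assumes "i \<le> n" "n \<le> k"
  shows "level i \<in> borel_measurable (PiM {1..n} D)"
  using assms(1)
proof (induction i)
  case 0
  then show ?case by simp
next
  case (Suc i)
  then have S: "Suc i \<in> {1..n}" "Suc i \<in> {1..k}" using assms(2) by auto
  have pair: "(\<lambda>v. (level i v, v (Suc i))) \<in> measurable (PiM {1..n} D) (borel \<Otimes>\<^sub>M D (Suc i))"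
    using Suc S by (intro measurable_Pair measurable_component_singleton) auto
  from measurable_compose[OF pair X_measurable[OF S(2)]] measurable_compose[OF pair P_measurable[OF S(2)]]
  have "(\<lambda>v. X (Suc i) (level i v) (v (Suc i))) \<in> borel_measurable (PiM {1..n} D)"
    "(\<lambda>v. P (Suc i) (level i v) (v (Suc i))) \<in> borel_measurable (PiM {1..n} D)" by simp_all
  with measurable_value[OF S(1) assms(2)] show ?case
    by (simp add: borel_measurable_diff borel_measurable_times)
qed

lemma composed_is_mechanism: "is_mechanism k D alloc pay"
  unfolding is_mechanism_def
proof (intro ballI conjI)
  fix i assume i: "i \<in> {1..k}"
  then obtain j where j: "i = Suc j" "j < k" by (cases i) auto
  then have ij: "i - 1 = j" by simp
  have pair: "(\<lambda>v. (level j v, v i)) \<in> measurable (PiM {1..i} D) (borel \<Otimes>\<^sub>M D i)"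
    using i j by (intro measurable_Pair measurable_component_singleton measurable_level) auto
  have X: "(\<lambda>v. X i (level j v) (v i)) \<in> borel_measurable (PiM {1..i} D)"
    and P: "(\<lambda>v. P i (level j v) (v i)) \<in> borel_measurable (PiM {1..i} D)"
    using measurable_compose[OF pair X_measurable[OF i]] measurable_compose[OF pair P_measurable[OF i]]
    by simp_all
  show "alloc i \<in> borel_measurable (PiM {1..i} D)"
    using X unfolding composed_allocation_def[abs_def] ij .
  show "pay i \<in> borel_measurable (PiM {1..i} D)"
    using X P measurable_value[of i i] i
    unfolding composed_payment_def[abs_def] ij
    by (cases "i < k") (simp_all add: borel_measurable_times)
  show "alloc i v \<in> {0..1}" if "v \<in> space (PiM {1..i} D)" for v
    using tight_feasibleD(3,4)[OF XP_feasible[OF j(2), of "level j v"], of "v i"] that j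
    by (auto simp: composed_allocation_def space_PiM PiE_def Pi_def)
qed

text \<open>Tightness makes the levels a martingale under truthful reports.\<close>

lemma nn_integral_level:
  assumes "i < k" "h \<in> space (PiM {1..i} D)"
  shows "(\<integral>\<^sup>+ v. ennreal (level (Suc i) (h(Suc i := v))) \<partial>D (Suc i)) = ennreal (level i h)"
proof -
  note hb = tight_feasibleD(6)[OF XP_feasible[OF assms(1), of "level i h"]]
  show ?thesis
    using nn_integral_eq_integral[OF integrable.intros[OF hb]] level_Suc_nonneg[OF assms]
      has_bochner_integral_integral_eq[OF hb]
    by simp
qed

text \<open>Promise keeping: only day \<open>k\<close> pays, and the martingale property carries its
  mean back to day \<open>i\<close>. The case \<open>i = k\<close> is excluded, as nothing follows
  day \<open>k\<close> although \<open>level k h\<close> may be positive.\<close>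

lemma later_utility_composed:
  assumes "i < k" "h \<in> space (PiM {1..i} D)"
  shows "expected_later (day_utility alloc pay) i h = ennreal (level i h)"
proof -
  have "i \<le> k - 1" using assms(1) by simp
  then show ?thesis using assms(2)
  proof (induction i arbitrary: h rule: inc_induct)
    case base
    have k: "Suc (k - 1) = k" using k_pos by simp
    have "expected_later (day_utility alloc pay) (k - 1) h =
      (\<integral>\<^sup>+ v. ennreal (level (Suc (k - 1)) (h(Suc (k - 1) := v))) \<partial>D (Suc (k - 1)))"
      using k_pos base unfolding k
      by (subst expected_later_step[OF measurable_day_rules(2)[OF composed_is_mechanism]])
        (auto simp: k day_utility_composed expected_later_k simp del: utility_level.simps)
    also have "\<dots> = ennreal (level (k - 1) h)"
      using nn_integral_level[OF _ base] k_pos by simp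
    finally show ?case .
  next
    case (step i)
    then have i: "i < k" "Suc i < k" by auto
    have "expected_later (day_utility alloc pay) i h =
      (\<integral>\<^sup>+ v. ennreal (level (Suc i) (h(Suc i := v))) \<partial>D (Suc i))"
      using i step.IH[OF extend_history[OF step.prems]]
      by (subst expected_later_step[OF measurable_day_rules(2)[OF composed_is_mechanism] i(1) step.prems])
        (auto simp: day_utility_composed simp del: utility_level.simps fun_upd_apply intro!: nn_integral_cong)
    also have "\<dots> = ennreal (level i h)"
      by (rule nn_integral_level[OF i(1) step.prems])
    finally show ?case .
  qed
qed

text \<open>After report \<open>v'\<close> on a day before the last, the charge
  \<open>v' * X\<close> cancels against the same term of the new level, leaving
  \<open>v i * X - P\<close> at the report \<open>v'\<close>. On the last day this is the direct
  utility, so single-day incentive compatibility suffices.\<close>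

lemma composed_periodic_IC: "periodic_IC k D alloc pay"
  unfolding periodic_IC_def
proof (intro ballI)
  fix i v v' assume i: "i \<in> {1..k}" and v: "v \<in> space (PiM {1..i} D)" and v': "v' \<in> space (D i)"
  obtain j where j: "i = Suc j" "j < k" using i by (cases i) auto
  have cont: "continuation_utility k D alloc pay i w = ereal (if i < k then level i w else 0)"
    if "w \<in> space (PiM {1..i} D)" for w
    using continuation_utility_eq[OF composed_ex_post_IR _ that] later_utility_composed[OF _ that]
      level_nonneg[OF _ _ that] i
    by (auto simp: expected_later_k enn2ereal_ennreal zero_ennreal.rep_eq zero_ereal_def
        simp del: utility_level.simps)
  have vi: "v i \<in> space (D i)" using v i by (auto simp: space_PiM)
  have "v i * X i (level j v) v' - P i (level j v) v' \<le> v i * X i (level j v) (v i) - P i (level j v) (v i)"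
    using tight_feasibleD(5)[OF XP_feasible[OF j(2)]] vi v' j(1) by simp
  then show "ereal (v i * alloc i (v(i := v')) - pay i (v(i := v')))
      + continuation_utility k D alloc pay i (v(i := v'))
    \<le> ereal (v i * alloc i v - pay i v) + continuation_utility k D alloc pay i v"
    unfolding cont[OF v] cont[OF update_history[OF v v' i]]
    using i j by (auto simp: composed_allocation_def composed_payment_def algebra_simps)
qed

text \<open>The counterpart of \<open>later_surplus_le_stage_value\<close> with equality: the new
  level is exactly the utility given to the tradeoff function, and the single-day mechanism is
  optimal.\<close>

lemma ghat_eq_later_surplus_step:
  assumes i: "i < k" and h: "h \<in> space (PiM {1..i} D)"
    and later: "\<And>h. h \<in> space (PiM {1..Suc i} D) \<Longrightarrow>
      expected_later (day_surplus alloc) (Suc i) h = e2ennreal (ghat k D (Suc (Suc i)) (level (Suc i) h))"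
  shows "ghat k D (Suc i) (level i h) =
    enn2ereal (expected_later (day_surplus alloc) i h) - ereal (first_day i * level i h)"
proof -
  interpret value_space "D (Suc i)" "lo (Suc i)" "hi (Suc i)" using i by (intro day) auto
  let ?x = "X (Suc i) (level i h)" and ?p = "P (Suc i) (level i h)"
  have "expected_later (day_surplus alloc) i h = stage_value (ghat k D (Suc (Suc i))) ?x ?p"
    using later[OF extend_history[OF h]]
    unfolding stage_value_def expected_later_step[OF measurable_day_rules(1)[OF composed_is_mechanism] i h]
    by (intro nn_integral_cong) (simp add: day_surplus_def composed_allocation_Suc)
  moreover have "tradeoff_function (ghat k D (Suc (Suc i)))"
    using i by (intro tradeoff_function_ghat) auto
  from tight_objective_nonneg_utility[OF this XP_feasible[OF i] first_day_nonneg level_Suc_nonneg[OF i h]]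
  have "ghat k D (Suc i) (level i h) =
      enn2ereal (stage_value (ghat k D (Suc (Suc i))) ?x ?p) - ereal (first_day i * level i h)"
    unfolding ghat_eq_objective[OF i] day_tradeoff_Suc by simp
  ultimately show ?thesis by simp
qed

lemma later_surplus_composed:
  assumes "1 \<le> i" "i \<le> k" "h \<in> space (PiM {1..i} D)"
  shows "expected_later (day_surplus alloc) i h = e2ennreal (ghat k D (Suc i) (level i h))"
  using assms(2,1,3)
proof (induction i arbitrary: h rule: inc_induct)
  case base
  then show ?case
    using level_nonneg[OF base(1) order_refl base(2)] by (simp add: expected_later_k ghat_after_last)
next
  case (step i)
  then show ?case
    using ghat_eq_later_surplus_step[OF \<open>i < k\<close> step.prems(2) step.IH]
    by (simp add: first_day_def zero_ereal_def[symmetric])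
qed

lemma revenue_composed: "revenue k D pay = ghat k D 1 c0"
proof -
  interpret value_space "D (Suc 0)" "lo (Suc 0)" "hi (Suc 0)" using k_pos by (intro day) auto
  \<comment> \<open>The sign of the maximizer is derived: \<open>c0\<close> is the mean of utilities
    that are nonnegative for every type.\<close>
  have "0 \<le> c0"
  proof (rule utility_level_nonneg[OF XP_feasible])
    show "0 \<le> v * X (Suc 0) c0 v - P (Suc 0) c0 v" if "v \<in> space (D (Suc 0))" for v
      using level_Suc_nonneg[OF _ empty_history that] k_pos by simp
  qed (use k_pos in simp)
  then show ?thesis
    using ghat_eq_later_surplus_step[OF _ empty_history later_surplus_composed] k_pos
      later_utility_composed[OF _ empty_history]
    by (simp add: revenue_eq[OF composed_is_mechanism composed_ex_post_IR] first_day_def enn2ereal_ennreal)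
qed

lemma composed_optimal: "optimal_mechanism k D alloc pay"
  unfolding optimal_mechanism_def feasible_mechanism_def[of k D alloc pay]
proof (intro conjI allI impI composed_is_mechanism composed_periodic_IC composed_ex_post_IR)
  fix x p assume "feasible_mechanism k D x p"
  then obtain c where "revenue k D p \<le> ghat k D 1 c" using revenue_le_ghat k_pos by metis
  also have "\<dots> \<le> revenue k D pay" unfolding revenue_composed by (rule c0_maximizer)
  finally show "revenue k D p \<le> revenue k D pay" .
qed

end

section \<open>Value distributions given by densities\<close>

text \<open>The complement is the union of all open null sets; by Lindelof countably many of them
  cover it.\<close>

lemma emeasure_outside_support:
  fixes M :: "'a::second_countable_topology measure"
  assumes "sets M = sets borel"
  shows "- measure_support M \<in> null_sets M"
proof -
  define \<F> where "\<F> = {U. open U \<and> emeasure M U = 0}"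
  have eq: "- measure_support M = \<Union>\<F>"
    by (auto simp: \<F>_def measure_support_def)
  obtain \<F>' where \<F>': "\<F>' \<subseteq> \<F>" "countable \<F>'" "\<Union>\<F>' = \<Union>\<F>"
    using Lindelof[of \<F>] by (auto simp: \<F>_def)
  have "\<Union>\<F>' \<in> null_sets M"
    using \<F>'(1,2) assms by (intro null_sets_UN'[of _ "\<lambda>U. U", simplified]) (auto simp: \<F>_def null_sets_def)
  then show ?thesis unfolding eq \<F>'(3) .
qed

lemma value_space_value_dist:
  assumes bounds: "0 \<le> lo i" "lo i < hi i" and dens: "density_with_support (f i) (lo i) (hi i)"
  shows "value_space (value_dist f lo hi i) (lo i) (hi i)"
proof -
  define N where "N = density lborel (\<lambda>v. ennreal (f i v))"
  have f [measurable]: "f i \<in> borel_measurable borel"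
    and one: "(\<integral>\<^sup>+ v. ennreal (f i v) \<partial>lborel) = 1"
    and supp: "measure_support N = {lo i..hi i}"
    using dens by (auto simp: density_with_support_def N_def)
  have sets_N [measurable_cong]: "sets N = sets borel" by (simp add: N_def)
  have null: "- {lo i..hi i} \<in> null_sets N"
    using emeasure_outside_support[OF sets_N] unfolding supp .
  have inter: "emeasure N (A \<inter> {lo i..hi i}) = emeasure N A" if "A \<in> sets borel" for A
    using emeasure_Diff_null_set[OF null, of A] that
    by (simp add: sets_N Diff_eq)
  have restr: "emeasure (value_dist f lo hi i) A = emeasure N A" if "A \<subseteq> {lo i..hi i}" for A
    unfolding value_dist_def N_def[symmetric] using that
    by (subst emeasure_restrict_space) (auto simp: sets_N)
  have space: "space (value_dist f lo hi i) = {lo i..hi i}"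
    by (simp add: value_dist_def space_restrict_space)
  show ?thesis
  proof (rule value_space.intro)
    have "emeasure N UNIV = 1"
      unfolding N_def using one by (subst emeasure_density) auto
    then show "prob_space (value_dist f lo hi i)"
      using inter[of UNIV] by (intro prob_spaceI) (simp add: space restr)
    show "value_space_axioms (value_dist f lo hi i) (lo i) (hi i)"
    proof
      show "sets (value_dist f lo hi i) = sets (restrict_space borel {lo i..hi i})"
        unfolding value_dist_def by (intro sets_restrict_space_cong) simp
      fix c assume "lo i < c"
      \<comment> \<open>The lower end belongs to the support, so every open ray
        \<open>{..<c}\<close> containing it has positive mass.\<close>
      moreover have "lo i \<in> measure_support N" using bounds by (simp add: supp)
      ultimately have "0 < emeasure N {..<c}"
        by (simp add: measure_support_def)
      also have "emeasure N {..<c} = emeasure N ({..<c} \<inter> {lo i..hi i})"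
        by (rule inter[symmetric]) simp
      also have "\<dots> = emeasure (value_dist f lo hi i) {v \<in> space (value_dist f lo hi i). v < c}"
        by (subst restr) (auto simp: space intro!: arg_cong[where f = "emeasure N"])
      finally show "0 < emeasure (value_dist f lo hi i) {v \<in> space (value_dist f lo hi i). v < c}" .
    qed (use bounds space in auto)
  qed
qed

theorem theorem7:
  fixes k :: nat
    and lo hi :: "nat \<Rightarrow> real"
    and f :: "nat \<Rightarrow> real \<Rightarrow> real"
    and D :: "nat \<Rightarrow> real measure"
    and X P :: "nat \<Rightarrow> real \<Rightarrow> real \<Rightarrow> real"
    and c0 :: real
  assumes "k \<ge> 1"
    and bounds: "\<And>i. i \<in> {1..k} \<Longrightarrow> 0 \<le> lo i \<and> lo i < hi i"
    and dens: "\<And>i. i \<in> {1..k} \<Longrightarrow> density_with_support (f i) (lo i) (hi i)"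
    and D: "D = value_dist f lo hi"
    and XP_optimal: "\<And>i c. i \<in> {1..k} \<Longrightarrow> tight_optimal (D i) c (day_tradeoff k D i) (X i c) (P i c)"
    and X_measurable: "\<And>i. i \<in> {1..k} \<Longrightarrow> (\<lambda>(c, v). X i c v) \<in> borel_measurable (borel \<Otimes>\<^sub>M D i)"
    and P_measurable: "\<And>i. i \<in> {1..k} \<Longrightarrow> (\<lambda>(c, v). P i c v) \<in> borel_measurable (borel \<Otimes>\<^sub>M D i)"
    and c0_maximizer: "\<And>c. ghat k D 1 c \<le> ghat k D 1 c0"
  shows "optimal_mechanism k D (composed_allocation X P c0) (composed_payment k X P c0)"
proof -
  interpret optimal_composition k D lo hi X P c0
  proof (intro optimal_composition.intro value_sequence.intro optimal_composition_axioms.intro)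
    show "value_space (D i) (lo i) (hi i)" if "i \<in> {1..k}" for i
      unfolding D using bounds[OF that] dens[OF that] by (intro value_space_value_dist) auto
  qed fact+
  show ?thesis by (rule composed_optimal)
qed

end
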